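(* (i) For every ordering $\sigma$ of the neighbours of the vertices of $\mathbb{Z}^2$ and every activity $\lambda>3.4$, strong spatial mixing (SSM) does not hold for the hard-core model at activity $\lambda$ on the tree $T_{\mathrm{saw}}^\sigma(\mathbb{Z}^2)$. (ii) For every homogeneous ordering $\sigma$ and every $\lambda>3$, SSM does not hold for the hard-core model at activity $\lambda$ on $T_{\mathrm{saw}}^\sigma(\mathbb{Z}^2)$.
   Context: Hard-core model: for a finite graph $H$ and activity $\lambda>0$, the Gibbs distribution on independent sets $I$ of $H$ is $\mu(I)\propto\lambda^{|I|}$; vertices in $I$ are occupied, others unoccupied. For a set $S$ of vertices and a configuration $\tau\in\{\text{occupied},\text{unoccupied}\}^S$ (compatible with some independent set), $p_v(\tau)$ denotes the conditional probability under $\mu$, given agreement with $\tau$ on $S$, that $v$ is unoccupied. For an infinite locally finite rooted tree $T$ with root $r$, $T_L$ denotes the finite subtree induced by the vertices at depth $\le L$. SSM holds for $T$ at activity $\lambda$ if there is $\gamma\in(0,1)$ such that for every $L$, every set $S$ of vertices of $T_L$, every $S'\subseteq S$ and every two configurations $\tau_1,\tau_2$ on $S$ that agree on $S\setminus S'$, one has $|p_r(\tau_1)-p_r(\tau_2)|\le\gamma^{\mathrm{dist}(r,S')}$ (probabilities computed in the hard-core model on $T_L$). Self-avoiding walk tree: steps in $\mathbb{Z}^2$ are $N=(0,1),S=(0,-1),E=(1,0),W=(-1,0)$. An ordering $\sigma=(\sigma_v)_{v\in\mathbb{Z}^2}$ assigns to each vertex $v$ a total order $\sigma_v$ of its four neighbours;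 $\sigma$ is homogeneous if there is one total order on $\{N,E,S,W\}$ such that for every $v$ the neighbours $v+d$ are ordered according to the order of the directions $d$. $T_{\mathrm{saw}}(\mathbb{Z}^2)$ is the rooted tree whose vertices are the nearest-neighbour walks $(v_0,\dots,v_m)$ with $v_0$ the origin, $v_0,\dots,v_{m-1}$ distinct, $v_m\neq v_{m-2}$, and either $v_m\notin\{v_0,\dots,v_{m-1}\}$ or $v_m=v_i$ for some $i$ (the latter walks are leaves and have no children); the parent of a walk is the walk with its last step removed, and the root is the walk of length $0$. A leaf $(v_0,\dots,v_i=w,v_{i+1},\dots,v_{m-1},v_m=w)$ is labelled unoccupied if $v_{i+1}$ is larger than $v_{m-1}$ in $\sigma_w$, and occupied if $v_{i+1}$ is smaller than $v_{m-1}$ in $\sigma_w$. $T_{\mathrm{saw}}^\sigma(\mathbb{Z}^2)$ is obtained from $T_{\mathrm{saw}}(\mathbb{Z}^2)$ by deleting every unoccupied leaf and, for every occupied leaf, deleting its parent together with the entire subtree rooted at that parent; it is rooted at the origin. *)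

theory Defs
  imports "HOL-Probability.Probability" "HOL-Library.Sublist"
begin

section \<open>Graphs and the hard-core model\<close>

text \<open>
  Simple undirected graphs: the edges are meant to form a symmetric irreflexive relation on the
  set of vertices.
\<close>

record 'a graph =
  verts :: "'a set"
  edges :: "('a \<times> 'a) set"

definition graph_dist :: "'a graph \<Rightarrow> 'a \<Rightarrow> 'a \<Rightarrow> nat" where
  "graph_dist G x y = (LEAST n. (x, y) \<in> edges G ^^ n)"

definition set_dist :: "'a graph \<Rightarrow> 'a \<Rightarrow> 'a set \<Rightarrow> nat" where
  "set_dist G x A = Inf (graph_dist G x ` A)"

definition induced :: "'a graph \<Rightarrow> 'a set \<Rightarrow> 'a graph" where
  "induced G A = \<lparr>verts = verts G \<inter> A, edges = edges G \<inter> A \<times> A\<rparr>"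

definition truncate :: "'a graph \<Rightarrow> 'a \<Rightarrow> nat \<Rightarrow> 'a graph" where
  "truncate T r L = induced T {x \<in> verts T. graph_dist T r x \<le> L}"

definition indep_sets :: "'a graph \<Rightarrow> 'a set set" where
  "indep_sets G = {I. I \<subseteq> verts G \<and> (\<forall>x\<in>I. \<forall>y\<in>I. (x, y) \<notin> edges G)}"

text \<open>Meaningful for a finite graph and a positive activity, see \<open>pmf_hard_core\<close> below.\<close>

definition hard_core :: "'a graph \<Rightarrow> real \<Rightarrow> 'a set pmf" where
  "hard_core G lam = embed_pmf (\<lambda>I. if I \<in> indep_sets G
     then lam ^ card I / (\<Sum>J\<in>indep_sets G. lam ^ card J) else 0)"

lemma pmf_hard_core:
  assumes "finite (verts G)" and "lam > 0"
  shows "pmf (hard_core G lam) I = (if I \<in> indep_sets G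
     then lam ^ card I / (\<Sum>J\<in>indep_sets G. lam ^ card J) else 0)"
proof -
  let ?Z = "\<Sum>J\<in>indep_sets G. lam ^ card J"
  let ?f = "\<lambda>I. if I \<in> indep_sets G then lam ^ card I / ?Z else 0"
  have fin: "finite (indep_sets G)"
    by (rule finite_subset[of _ "Pow (verts G)"]) (use assms in \<open>auto simp: indep_sets_def\<close>)
  have "{} \<in> indep_sets G" by (auto simp: indep_sets_def)
  then have Z: "?Z > 0" using fin assms by (intro sum_pos) auto
  have nonneg: "?f J \<ge> 0" for J using Z assms by auto
  have "(\<integral>\<^sup>+J. ennreal (?f J) \<partial>count_space UNIV)
      = (\<integral>\<^sup>+J. ennreal (?f J) * indicator (indep_sets G) J \<partial>count_space UNIV)"
    by (intro nn_integral_cong) (auto simp: indicator_def)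
  also have "\<dots> = (\<Sum>J\<in>indep_sets G. ennreal (?f J))"
    using fin by (simp add: nn_integral_count_space_indicator[symmetric] nn_integral_count_space_finite)
  also have "\<dots> = ennreal (\<Sum>J\<in>indep_sets G. ?f J)"
    by (intro sum_ennreal nonneg)
  also have "(\<Sum>J\<in>indep_sets G. ?f J) = (\<Sum>J\<in>indep_sets G. lam ^ card J / ?Z)"
    by (intro sum.cong) auto
  also have "\<dots> = 1" using Z by (simp add: sum_divide_distrib[symmetric])
  finally show ?thesis
    unfolding hard_core_def by (subst pmf_embed_pmf) (use nonneg in auto)
qed

text \<open>
  A configuration on \<open>S\<close> is a function to \<^typ>\<open>bool\<close>, with \<^const>\<open>True\<close> for occupied, of which only
  the values on \<open>S\<close> are used.
\<close>

definition agrees :: "'a set \<Rightarrow> ('a \<Rightarrow> bool) \<Rightarrow> 'a set \<Rightarrow> bool" where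
  "agrees S \<tau> I \<longleftrightarrow> (\<forall>x\<in>S. x \<in> I \<longleftrightarrow> \<tau> x)"

definition compatible :: "'a graph \<Rightarrow> 'a set \<Rightarrow> ('a \<Rightarrow> bool) \<Rightarrow> bool" where
  "compatible G S \<tau> \<longleftrightarrow> (\<exists>I\<in>indep_sets G. agrees S \<tau> I)"

definition p_unocc :: "'a graph \<Rightarrow> real \<Rightarrow> 'a \<Rightarrow> 'a set \<Rightarrow> ('a \<Rightarrow> bool) \<Rightarrow> real" where
  "p_unocc G lam v S \<tau> = \<P>(I in measure_pmf (hard_core G lam). v \<notin> I \<bar> agrees S \<tau> I)"

text \<open>
  For \<open>S' = {}\<close> the distance is the junk value \<open>0\<close>, but then the two configurations coincide on \<open>S\<close>
  and the required bound is trivial.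
\<close>

definition SSM :: "'a graph \<Rightarrow> 'a \<Rightarrow> real \<Rightarrow> bool" where
  "SSM T r lam \<longleftrightarrow> (\<exists>\<gamma>::real. 0 < \<gamma> \<and> \<gamma> < 1 \<and>
     (\<forall>L S S' \<tau>\<^sub>1 \<tau>\<^sub>2. S \<subseteq> verts (truncate T r L) \<and> S' \<subseteq> S \<and>
        compatible (truncate T r L) S \<tau>\<^sub>1 \<and> compatible (truncate T r L) S \<tau>\<^sub>2 \<and>
        (\<forall>x\<in>S - S'. \<tau>\<^sub>1 x = \<tau>\<^sub>2 x) \<longrightarrow>
        \<bar>p_unocc (truncate T r L) lam r S \<tau>\<^sub>1 - p_unocc (truncate T r L) lam r S \<tau>\<^sub>2\<bar>
          \<le> \<gamma> ^ set_dist (truncate T r L) r S'))"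


section \<open>Self-avoiding walk trees of the square lattice\<close>

type_synonym site = "int \<times> int"

definition directions :: "site set" where
  "directions = {(0, 1), (0, -1), (1, 0), (-1, 0)}"

definition neighbours :: "site \<Rightarrow> site set" where
  "neighbours v = (\<lambda>d. v + d) ` directions"

text \<open>\<open>(x, y) \<in> \<sigma> v\<close> means that \<open>x\<close> is smaller than or equal to \<open>y\<close> in the order at \<open>v\<close>.\<close>

definition nbr_ordering :: "(site \<Rightarrow> site rel) \<Rightarrow> bool" where
  "nbr_ordering \<sigma> \<longleftrightarrow> (\<forall>v. linear_order_on (neighbours v) (\<sigma> v))"

definition homogeneous :: "(site \<Rightarrow> site rel) \<Rightarrow> bool" where
  "homogeneous \<sigma> \<longleftrightarrow> (\<exists>R. linear_order_on directions R \<and>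
     (\<forall>v. \<forall>d\<in>directions. \<forall>e\<in>directions. (v + d, v + e) \<in> \<sigma> v \<longleftrightarrow> (d, e) \<in> R))"

text \<open>
  The walk \<open>(v\<^sub>0, \<dots>, v\<^sub>m)\<close> is the list of its \<open>m + 1\<close> sites. The last site may or may not be one of
  the earlier ones.
\<close>

definition saw_walks :: "site list set" where
  "saw_walks = {p. p \<noteq> [] \<and> hd p = (0, 0) \<and>
     (\<forall>i. Suc i < length p \<longrightarrow> p ! Suc i \<in> neighbours (p ! i)) \<and>
     distinct (butlast p) \<and>
     (length p \<ge> 3 \<longrightarrow> p ! (length p - 1) \<noteq> p ! (length p - 3))}"

text \<open>For a leaf, \<open>last p = p ! i\<close> and \<open>p ! (length p - 2)\<close> is the site before the last one.\<close>

definition unoccupied_leaf :: "(site \<Rightarrow> site rel) \<Rightarrow> site list \<Rightarrow> bool" where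
  "unoccupied_leaf \<sigma> p \<longleftrightarrow> p \<in> saw_walks \<and>
     (\<exists>i < length p - 1. p ! i = last p \<and>
        p ! Suc i \<noteq> p ! (length p - 2) \<and> (p ! (length p - 2), p ! Suc i) \<in> \<sigma> (last p))"

definition occupied_leaf :: "(site \<Rightarrow> site rel) \<Rightarrow> site list \<Rightarrow> bool" where
  "occupied_leaf \<sigma> p \<longleftrightarrow> p \<in> saw_walks \<and>
     (\<exists>i < length p - 1. p ! i = last p \<and>
        p ! Suc i \<noteq> p ! (length p - 2) \<and> (p ! Suc i, p ! (length p - 2)) \<in> \<sigma> (last p))"

definition walk_tree :: "site list set \<Rightarrow> site list graph" where
  "walk_tree V = \<lparr>verts = V,
     edges = {(p, q). p \<in> V \<and> q \<in> V \<and> (q \<noteq> [] \<and> p = butlast q \<or> p \<noteq> [] \<and> q = butlast p)}\<rparr>"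

definition T_saw :: "site list graph" where
  "T_saw = walk_tree saw_walks"

text \<open>
  The subtree rooted at a walk consists of its extensions, and the parent of \<open>q\<close> is \<open>butlast q\<close>.
\<close>

definition T_saw_ord :: "(site \<Rightarrow> site rel) \<Rightarrow> site list graph" where
  "T_saw_ord \<sigma> = induced T_saw
     {p. \<not> unoccupied_leaf \<sigma> p \<and> \<not> (\<exists>q. occupied_leaf \<sigma> q \<and> prefix (butlast q) p)}"

definition saw_root :: "site list" where
  "saw_root = [(0, 0)]"

end

theory Submission
  imports Defs
begin

text \<open>
  Conditioning all vertices outside a subtree of $T_{saw}^\sigma$ to be unoccupied reduces the
  claim to the absence of decay on that subtree. On a tree, the probability $x_v$ that $v$ is
  unoccupied in the subtree below it satisfies $x_v = 1 / (1 + \lambda \prod_c x_c)$, the product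
  being over the children of $v$. This map is antitone, so it suffices to find bounds
  $l_v \le u_v$ with $l$ mapped above $u$ and $u$ mapped below $l$: the values at the root then
  oscillate between the two as the cutoff depth alternates.

  For a homogeneous ordering, let $d$ be the smallest direction and take all walks with steps in
  $d$, $e$, $-e$, where $e$ is perpendicular to $d$, without immediate reversals. Such a walk can
  only close a cycle by stepping in direction $-d$ onto a site that it left in a direction
  $\pm e$, and minimality of $d$ makes that leaf unoccupied, so the walk is kept. For $\lambda > 3$ the
  recursion has an explicit 2-cycle. For an arbitrary ordering, the patterns $e, d, -e$ and
  $-e, d, e$ are forbidden as well; then the walks are induced paths and are always kept, and suitable
  bounds exist for $\lambda > 3.4$.
\<close>

section \<open>Partition functions on trees of walks\<close>

text \<open>The edge relation of \<open>walk_tree A\<close> without the membership conditions, so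
  that one relation serves all vertex sets arising by deletion.\<close>

definition adj :: "site list \<Rightarrow> site list \<Rightarrow> bool" where
  "adj p q \<longleftrightarrow> q \<noteq> [] \<and> p = butlast q \<or> p \<noteq> [] \<and> q = butlast p"

definition part_fun :: "real \<Rightarrow> site list set \<Rightarrow> real" where
  "part_fun lam A = (\<Sum>I\<in>indep_sets (walk_tree A). lam ^ card I)"

lemma adj_sym: "adj p q \<longleftrightarrow> adj q p"
  by (auto simp: adj_def)

lemma adj_length: "adj p q \<Longrightarrow> length q = Suc (length p) \<or> length p = Suc (length q)"
  by (auto simp: adj_def)

lemma verts_walk_tree [simp]: "verts (walk_tree A) = A"
  by (simp add: walk_tree_def)

lemma edges_walk_tree: "(p, q) \<in> edges (walk_tree A) \<longleftrightarrow> p \<in> A \<and> q \<in> A \<and> adj p q"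
  by (auto simp: walk_tree_def adj_def)

lemma induced_walk_tree: "induced (walk_tree A) B = walk_tree (A \<inter> B)"
  by (auto simp: induced_def walk_tree_def)

lemma indep_sets_walk_tree:
  "I \<in> indep_sets (walk_tree A) \<longleftrightarrow> I \<subseteq> A \<and> (\<forall>x\<in>I. \<forall>y\<in>I. \<not> adj x y)"
  by (auto simp: indep_sets_def edges_walk_tree)

lemma finite_indep_sets: "finite A \<Longrightarrow> finite (indep_sets (walk_tree A))"
  by (rule finite_subset[of _ "Pow A"]) (auto simp: indep_sets_walk_tree)

lemma part_fun_empty [simp]: "part_fun lam {} = 1"
proof -
  have "indep_sets (walk_tree {}) = {{}}" by (auto simp: indep_sets_walk_tree)
  then show ?thesis by (simp add: part_fun_def)
qed

lemma part_fun_pos: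
  assumes "finite A" "lam > 0"
  shows "part_fun lam A > 0"
proof -
  have "{} \<in> indep_sets (walk_tree A)" by (auto simp: indep_sets_walk_tree)
  then show ?thesis
    unfolding part_fun_def using assms finite_indep_sets by (intro sum_pos) auto
qed

text \<open>No edge crosses, so intersecting with \<open>A\<close> and with \<open>B\<close>
  identifies the independent sets of the union with pairs, and cardinalities add.\<close>

lemma part_fun_union:
  assumes fin: "finite A" "finite B" and disj: "A \<inter> B = {}"
    and sep: "\<And>a b. a \<in> A \<Longrightarrow> b \<in> B \<Longrightarrow> \<not> adj a b"
  shows "part_fun lam (A \<union> B) = part_fun lam A * part_fun lam B"
proof -
  let ?I = "\<lambda>A. indep_sets (walk_tree A)"
  have "part_fun lam A * part_fun lam B = (\<Sum>(I, J)\<in>?I A \<times> ?I B. lam ^ card I * lam ^ card J)"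
    by (simp add: part_fun_def sum_product sum.cartesian_product)
  also have "\<dots> = (\<Sum>K\<in>?I (A \<union> B). lam ^ card K)"
  proof (rule sum.reindex_bij_witness[where i = "\<lambda>K. (K \<inter> A, K \<inter> B)" and j = "\<lambda>(I, J). I \<union> J"], goal_cases)
    case (1 a)
    then show ?case using disj by (fastforce simp: indep_sets_walk_tree)
  next
    case (2 a)
    have sep': "\<not> adj b a" if "a \<in> A" "b \<in> B" for a b
      using sep[OF that] adj_sym[of a b] by simp
    obtain I J where a: "a = (I, J)" by force
    have "I \<subseteq> A" "J \<subseteq> B" "\<forall>x\<in>I. \<forall>y\<in>I. \<not> adj x y" "\<forall>x\<in>J. \<forall>y\<in>J. \<not> adj x y"
      using 2 a by (auto simp: indep_sets_walk_tree)
    then have "I \<union> J \<subseteq> A \<union> B" "\<forall>x\<in>I \<union> J. \<forall>y\<in>I \<union> J. \<not> adj x y"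
      using sep sep' by blast+
    then show ?case by (simp add: a indep_sets_walk_tree)
  next
    case (3 b)
    then show ?case by (auto simp: indep_sets_walk_tree)
  next
    case (4 b)
    then show ?case by (auto simp: indep_sets_walk_tree)
  next
    case (5 a)
    obtain I J where a: "a = (I, J)" by force
    have "I \<subseteq> A" "J \<subseteq> B" using 5 a by (auto simp: indep_sets_walk_tree)
    then have "card (I \<union> J) = card I + card J"
      using fin disj by (intro card_Un_disjoint) (auto intro: finite_subset)
    then show ?case by (simp add: a power_add)
  qed
  finally show ?thesis by (simp add: part_fun_def)
qed

lemma part_fun_UN:
  assumes "finite M" and "\<And>i. i \<in> M \<Longrightarrow> finite (A i)"
    and "\<And>i j. i \<in> M \<Longrightarrow> j \<in> M \<Longrightarrow> i \<noteq> j \<Longrightarrow> A i \<inter> A j = {}"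
    and "\<And>i j a b. i \<in> M \<Longrightarrow> j \<in> M \<Longrightarrow> i \<noteq> j \<Longrightarrow> a \<in> A i \<Longrightarrow> b \<in> A j \<Longrightarrow> \<not> adj a b"
  shows "part_fun lam (\<Union>i\<in>M. A i) = (\<Prod>i\<in>M. part_fun lam (A i))"
  using assms
proof (induction M rule: finite_induct)
  case empty
  then show ?case by simp
next
  case (insert m M)
  have "part_fun lam (A m \<union> (\<Union>i\<in>M. A i)) = part_fun lam (A m) * part_fun lam (\<Union>i\<in>M. A i)"
  proof (rule part_fun_union)
    show "A m \<inter> (\<Union>i\<in>M. A i) = {}"
      using insert.prems(2) insert.hyps by fastforce
    show "\<not> adj a b" if "a \<in> A m" "b \<in> (\<Union>i\<in>M. A i)" for a b
      using insert.prems(3) insert.hyps that by blast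
  qed (use insert in auto)
  moreover have "part_fun lam (\<Union>i\<in>M. A i) = (\<Prod>i\<in>M. part_fun lam (A i))"
    by (intro insert.IH insert.prems) auto
  ultimately show ?case using insert.hyps by simp
qed

text \<open>Conditioning is deletion: an agreeing set equals \<open>B\<close> inside
  \<open>S\<close>, and outside \<open>S\<close> it may use exactly the vertices not adjacent to
  \<open>B\<close>.\<close>

lemma sum_agrees:
  assumes fin: "finite V" and B: "B \<subseteq> S" "S \<subseteq> V" "\<And>x y. x \<in> B \<Longrightarrow> y \<in> B \<Longrightarrow> \<not> adj x y"
  shows "(\<Sum>I | I \<in> indep_sets (walk_tree V) \<and> agrees S (\<lambda>x. x \<in> B) I. lam ^ card I)
    = lam ^ card B * part_fun lam {x \<in> V - S. \<forall>y\<in>B. \<not> adj x y}"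
proof -
  let ?U = "{x \<in> V - S. \<forall>y\<in>B. \<not> adj x y}"
  have "lam ^ card B * part_fun lam ?U = (\<Sum>J\<in>indep_sets (walk_tree ?U). lam ^ card B * lam ^ card J)"
    by (simp add: part_fun_def sum_distrib_left)
  also have "\<dots> = (\<Sum>I | I \<in> indep_sets (walk_tree V) \<and> agrees S (\<lambda>x. x \<in> B) I. lam ^ card I)"
  proof (rule sum.reindex_bij_witness[where i = "\<lambda>I. I - S" and j = "\<lambda>J. J \<union> B"], goal_cases)
    case (1 a)
    then show ?case using B by (auto simp: indep_sets_walk_tree)
  next
    case (2 a)
    then have a: "a \<subseteq> V - S" "\<forall>x\<in>a. \<forall>y\<in>a. \<not> adj x y" "\<forall>x\<in>a. \<forall>y\<in>B. \<not> adj x y"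
      by (auto simp: indep_sets_walk_tree)
    then have "\<forall>x\<in>B. \<forall>y\<in>a. \<not> adj x y" using adj_sym by metis
    with a B have "a \<union> B \<subseteq> V" "\<forall>x\<in>a \<union> B. \<forall>y\<in>a \<union> B. \<not> adj x y" by blast+
    with a B show ?case by (auto simp: indep_sets_walk_tree agrees_def)
  next
    case (3 b)
    then show ?case using B by (auto simp: indep_sets_walk_tree agrees_def)
  next
    case (4 b)
    then show ?case using B by (auto simp: indep_sets_walk_tree agrees_def)
  next
    case (5 a)
    have "a \<subseteq> ?U" using 5 by (auto simp: indep_sets_walk_tree)
    then have "card (a \<union> B) = card a + card B"
      using fin B by (intro card_Un_disjoint) (auto intro: finite_subset)
    then show ?case by (simp add: power_add)
  qed
  finally show ?thesis by simp
qed

text \<open>Both states of \<open>p\<close> are conditionings on \<open>{p}\<close>; the occupied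
  one also deletes the neighbours of \<open>p\<close>.\<close>

lemma part_fun_insert:
  assumes "finite A" "p \<notin> A"
  shows "part_fun lam (insert p A) = part_fun lam A + lam * part_fun lam {x \<in> A. \<not> adj x p}"
proof -
  let ?V = "insert p A"
  have *: "\<not> adj p p" using adj_length by fastforce
  have "part_fun lam ?V
      = (\<Sum>I | I \<in> indep_sets (walk_tree ?V) \<and> agrees {p} (\<lambda>x. x \<in> {}) I. lam ^ card I)
      + (\<Sum>I | I \<in> indep_sets (walk_tree ?V) \<and> agrees {p} (\<lambda>x. x \<in> {p}) I. lam ^ card I)"
    unfolding part_fun_def using assms finite_indep_sets[of ?V]
    by (subst sum.union_disjoint[symmetric]) (auto simp: agrees_def intro!: sum.cong)
  also have "(\<Sum>I | I \<in> indep_sets (walk_tree ?V) \<and> agrees {p} (\<lambda>x. x \<in> {}) I. lam ^ card I)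
      = lam ^ card ({} :: site list set) * part_fun lam {x \<in> ?V - {p}. \<forall>y\<in>{}. \<not> adj x y}"
    by (rule sum_agrees) (use assms in auto)
  also have "(\<Sum>I | I \<in> indep_sets (walk_tree ?V) \<and> agrees {p} (\<lambda>x. x \<in> {p}) I. lam ^ card I)
      = lam ^ card {p} * part_fun lam {x \<in> ?V - {p}. \<forall>y\<in>{p}. \<not> adj x y}"
    by (rule sum_agrees) (use assms * in auto)
  also have "{x \<in> ?V - {p}. \<forall>y\<in>{}. \<not> adj x y} = A"
    using assms by auto
  also have "{x \<in> ?V - {p}. \<forall>y\<in>{p}. \<not> adj x y} = {x \<in> A. \<not> adj x p}"
    using assms by auto
  finally show ?thesis by simp
qed

lemma p_unocc_walk_tree:
  assumes fin: "finite V" and lam: "lam > 0"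
    and B: "B \<subseteq> S" "S \<subseteq> V" "\<And>x y. x \<in> B \<Longrightarrow> y \<in> B \<Longrightarrow> \<not> adj x y"
    and r: "r \<in> V" "r \<notin> B"
    and U: "U = {x \<in> V - S. \<forall>y\<in>B. \<not> adj x y}"
  shows "p_unocc (walk_tree V) lam r S (\<lambda>x. x \<in> B) = part_fun lam (U - {r}) / part_fun lam U"
proof -
  let ?I = "indep_sets (walk_tree V)" and ?Z = "part_fun lam V"
  let ?M = "measure_pmf (hard_core (walk_tree V) lam)"
  have Z: "?Z > 0" using fin lam by (rule part_fun_pos)
  have pmf: "pmf (hard_core (walk_tree V) lam) I = (if I \<in> ?I then lam ^ card I / ?Z else 0)" for I
    using fin lam by (simp add: pmf_hard_core part_fun_def)
  have meas: "measure ?M {I. P I} = (\<Sum>I | I \<in> ?I \<and> P I. lam ^ card I) / ?Z" for P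
  proof -
    have "measure ?M {I. P I} = measure ?M {I \<in> ?I. P I}"
      by (rule measure_eq_AE) (auto simp: AE_measure_pmf_iff set_pmf_iff pmf split: if_splits)
    also have "\<dots> = (\<Sum>I | I \<in> ?I \<and> P I. lam ^ card I / ?Z)"
      using finite_indep_sets[OF fin] by (subst measure_measure_pmf_finite) (auto simp: pmf intro!: sum.cong)
    finally show ?thesis by (simp add: sum_divide_distrib)
  qed
  \<comment> \<open>As \<open>r\<close> is not in \<open>B\<close>, requiring \<open>r\<close> to be
    unoccupied enlarges \<open>S\<close> to \<open>insert r S\<close> with the same
    \<open>B\<close>; the weight \<open>lam ^ card B\<close> then cancels.\<close>
  have eq: "(r \<notin> I \<and> agrees S (\<lambda>x. x \<in> B) I) = agrees (insert r S) (\<lambda>x. x \<in> B) I" for I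
    using r by (auto simp: agrees_def)
  have U': "U - {r} = {x \<in> V - insert r S. \<forall>y\<in>B. \<not> adj x y}"
    using U by auto
  have "p_unocc (walk_tree V) lam r S (\<lambda>x. x \<in> B)
      = (lam ^ card B * part_fun lam (U - {r}) / ?Z) / (lam ^ card B * part_fun lam U / ?Z)"
    unfolding p_unocc_def cond_prob_def U' using fin B r
    by (simp add: eq meas sum_agrees U insert_absorb subset_insertI2)
  then show ?thesis using Z lam by simp
qed

section \<open>Distances in trees of walks\<close>

text \<open>The connected subtrees containing the root; the full tree, its truncations and the
  oscillating subtree are all instances.\<close>

locale rooted_walks =
  fixes V :: "site list set" and r :: site
  assumes root: "[r] \<in> V"
    and hd_root: "\<And>p. p \<in> V \<Longrightarrow> p \<noteq> [] \<and> hd p = r"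
    and butlast_closed: "\<And>p. p \<in> V \<Longrightarrow> length p \<ge> 2 \<Longrightarrow> butlast p \<in> V"
begin

lemma path_to:
  assumes "p \<in> V"
  shows "([r], p) \<in> edges (walk_tree V) ^^ (length p - 1)"
  using assms
proof (induction "length p" arbitrary: p)
  case 0
  then show ?case using hd_root by simp
next
  case (Suc n)
  show ?case
  proof (cases n)
    case 0
    then have "p = [r]" using Suc hd_root[of p] by (cases p) auto
    then show ?thesis by simp
  next
    case (Suc m)
    have b: "butlast p \<in> V" using Suc \<open>Suc n = length p\<close> \<open>p \<in> V\<close> butlast_closed by auto
    have len: "length p - 1 = Suc (length (butlast p) - 1)" using Suc \<open>Suc n = length p\<close> by simp
    have "([r], butlast p) \<in> edges (walk_tree V) ^^ (length (butlast p) - 1)"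
      using Suc.hyps(1)[of "butlast p"] \<open>Suc n = length p\<close> b
      by (metis diff_Suc_1 length_butlast)
    moreover have "(butlast p, p) \<in> edges (walk_tree V)"
      using b \<open>p \<in> V\<close> hd_root by (auto simp: edges_walk_tree adj_def)
    ultimately show ?thesis unfolding len by auto
  qed
qed

text \<open>The path through the prefixes is shortest because every edge changes the length by
  exactly one.\<close>

lemma graph_dist_root:
  assumes "p \<in> V"
  shows "graph_dist (walk_tree V) [r] p = length p - 1"
  unfolding graph_dist_def
proof (rule Least_equality)
  show "([r], p) \<in> edges (walk_tree V) ^^ (length p - 1)" using assms by (rule path_to)
next
  fix n
  have "([r], p) \<in> edges (walk_tree V) ^^ n \<Longrightarrow> length p \<le> Suc n" for p
  proof (induction n arbitrary: p)
    case (Suc n)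
    then obtain z where z: "([r], z) \<in> edges (walk_tree V) ^^ n" "(z, p) \<in> edges (walk_tree V)"
      by auto
    then show ?case using Suc.IH[OF z(1)] adj_length by (fastforce simp: edges_walk_tree)
  qed simp
  then show "([r], p) \<in> edges (walk_tree V) ^^ n \<Longrightarrow> length p - 1 \<le> n"
    by fastforce
qed

lemma truncate_walk_tree: "truncate (walk_tree V) [r] L = walk_tree {p \<in> V. length p \<le> Suc L}"
proof -
  have "V \<inter> {x \<in> V. graph_dist (walk_tree V) [r] x \<le> L} = {p \<in> V. length p \<le> Suc L}"
    using graph_dist_root by force
  then show ?thesis by (simp add: truncate_def induced_walk_tree)
qed

lemma rooted_walks_truncate: "rooted_walks {p \<in> V. length p \<le> Suc L} r"
  using root hd_root butlast_closed by unfold_locales auto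

lemma prefix_closed: "x \<in> V \<Longrightarrow> prefix p x \<Longrightarrow> p \<noteq> [] \<Longrightarrow> p \<in> V"
proof (induction x rule: rev_induct)
  case Nil
  then show ?case using hd_root by auto
next
  case (snoc v xs)
  show ?case
  proof (cases "p = xs @ [v]")
    case False
    then have p: "prefix p xs" using snoc.prems by simp
    then have "xs \<noteq> []" using snoc.prems by auto
    then have "length (xs @ [v]) \<ge> 2" by (cases xs) auto
    then have "xs \<in> V" using butlast_closed[OF snoc.prems(1)] by simp
    then show ?thesis using snoc.IH p snoc.prems by blast
  qed (use snoc in simp)
qed

end

section \<open>Failure of strong spatial mixing from a subtree\<close>

text \<open>\<open>V\<close> is the tree for which mixing is refuted, \<open>W\<close> the subtree
  left free by the boundary condition. Finite levels make truncations finite;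
  \<open>extendable\<close> lets every vertex of \<open>W\<close> be blocked by an occupied
  child.\<close>

locale walk_subtree = rooted_walks V r + sub: rooted_walks W r for V W r +
  assumes subset: "W \<subseteq> V"
    and finite_levels: "\<And>n. finite {p \<in> V. length p \<le> n}"
    and extendable: "\<And>p. p \<in> W \<Longrightarrow> \<exists>v. p @ [v] \<in> W"
begin

section \<open>Recursion for the unoccupied probability on a subtree\<close>

definition children :: "site list \<Rightarrow> site set" where
  "children p = {v. p @ [v] \<in> W}"

text \<open>\<open>k\<close> counts levels including that of \<open>p\<close>: for \<open>p\<close>
  in \<open>W\<close>, \<open>branch p 0\<close> is empty and \<open>branch p 1\<close> is
  \<open>{p}\<close>.\<close>

definition branch :: "site list \<Rightarrow> nat \<Rightarrow> site list set" where
  "branch p k = {x \<in> W. prefix p x \<and> length x < length p + k}"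

text \<open>The probability that \<open>p\<close> is unoccupied in the hard-core model on
  \<open>branch p k\<close>. For \<open>k = 0\<close> the quotient is 1, as suits a deleted
  vertex.\<close>

definition unocc :: "real \<Rightarrow> site list \<Rightarrow> nat \<Rightarrow> real" where
  "unocc lam p k = part_fun lam (branch p k - {p}) / part_fun lam (branch p k)"

lemma finite_branch: "finite (branch p k)"
  by (rule finite_subset[OF _ finite_levels[of "length p + k"]]) (use subset in \<open>auto simp: branch_def\<close>)

lemma finite_children: "finite (children p)"
proof -
  have "children p \<subseteq> last ` {q \<in> V. length q \<le> Suc (length p)}"
    using subset by (force simp: children_def image_iff)
  then show ?thesis using finite_levels finite_subset by blast
qed

lemma branch_Suc:
  assumes "p \<in> W"
  shows "branch p (Suc k) = insert p (\<Union>v\<in>children p. branch (p @ [v]) k)"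
proof (intro equalityI subsetI)
  fix x assume x: "x \<in> branch p (Suc k)"
  show "x \<in> insert p (\<Union>v\<in>children p. branch (p @ [v]) k)"
  proof (cases "x = p")
    case False
    obtain zs where zs: "x = p @ zs" using x by (auto simp: branch_def prefix_def)
    with False obtain v ys where "zs = v # ys" by (cases zs) auto
    with zs have "prefix (p @ [v]) x" by simp
    moreover from this have "p @ [v] \<in> W"
      using x sub.prefix_closed by (auto simp: branch_def)
    ultimately have "v \<in> children p" "x \<in> branch (p @ [v]) k"
      using x by (auto simp: branch_def children_def)
    then show ?thesis by blast
  qed simp
next
  fix x assume "x \<in> insert p (\<Union>v\<in>children p. branch (p @ [v]) k)"
  then show "x \<in> branch p (Suc k)"
    using assms by (auto simp: branch_def dest: append_prefixD)
qed

lemma branch_nth: "x \<in> branch (p @ [v]) k \<Longrightarrow> length p < length x \<and> x ! length p = v"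
  by (auto simp: branch_def prefix_def nth_append)

text \<open>Such walks differ at index \<open>length p\<close>, whereas adjacent walks agree at
  every index that both possess.\<close>

lemma branch_separated:
  assumes "v \<noteq> w" "x \<in> branch (p @ [v]) k" "y \<in> branch (p @ [w]) k"
  shows "x \<noteq> y \<and> \<not> adj x y"
proof
  show "x \<noteq> y" using assms branch_nth by blast
  have "x ! length p \<noteq> y ! length p" "length p < length x" "length p < length y"
    using assms branch_nth by blast+
  moreover from this have "x \<noteq> butlast y" "y \<noteq> butlast x"
    by (metis length_butlast nth_butlast)+
  ultimately show "\<not> adj x y" by (simp add: adj_def)
qed

lemma branch_adj:
  assumes "x \<in> branch (p @ [v]) k"
  shows "adj x p \<longleftrightarrow> x = p @ [v]"
proof
  assume "adj x p"
  then have "length x = Suc (length p)"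
    using branch_nth[OF assms] adj_length by fastforce
  moreover obtain zs where "x = (p @ [v]) @ zs"
    using assms by (auto simp: branch_def prefix_def)
  ultimately show "x = p @ [v]" by simp
qed (simp add: adj_def)

lemma unocc_0: "unocc lam p 0 = 1"
proof -
  have "branch p 0 = {}" by (auto simp: branch_def dest: prefix_length_le)
  then show ?thesis by (simp add: unocc_def)
qed

text \<open>Deleting \<open>p\<close> splits its branch into the separated branches of the children;
  occupying \<open>p\<close> also deletes the children themselves.\<close>

lemma unocc_Suc:
  assumes "p \<in> W" "lam > 0"
  shows "unocc lam p (Suc k) = 1 / (1 + lam * (\<Prod>v\<in>children p. unocc lam (p @ [v]) k))"
proof -
  let ?U = "\<Union>v\<in>children p. branch (p @ [v]) k"
  let ?a = "\<lambda>v. part_fun lam (branch (p @ [v]) k)"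
  let ?b = "\<lambda>v. part_fun lam (branch (p @ [v]) k - {p @ [v]})"
  have fin: "finite ?U" using finite_children finite_branch by blast
  have p: "p \<notin> ?U" using branch_nth by blast
  have a: "part_fun lam ?U = (\<Prod>v\<in>children p. ?a v)"
    using branch_separated by (intro part_fun_UN finite_children finite_branch) blast+
  have "{x \<in> ?U. \<not> adj x p} = (\<Union>v\<in>children p. branch (p @ [v]) k - {p @ [v]})"
    using branch_adj by blast
  also have "part_fun lam \<dots> = (\<Prod>v\<in>children p. ?b v)"
    using branch_separated by (intro part_fun_UN finite_children finite_Diff finite_branch) blast+
  finally have b: "part_fun lam {x \<in> ?U. \<not> adj x p} = (\<Prod>v\<in>children p. ?b v)" .
  have pos: "(\<Prod>v\<in>children p. ?a v) > 0"
    using part_fun_pos finite_branch assms by (intro prod_pos) auto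
  have "unocc lam p (Suc k) = (\<Prod>v\<in>children p. ?a v) / ((\<Prod>v\<in>children p. ?a v) + lam * (\<Prod>v\<in>children p. ?b v))"
    unfolding unocc_def branch_Suc[OF assms(1)] part_fun_insert[OF fin p] a[symmetric] b[symmetric]
    using p by simp
  also have "\<dots> = 1 / (1 + lam * ((\<Prod>v\<in>children p. ?b v) / (\<Prod>v\<in>children p. ?a v)))"
    using pos by (simp add: divide_simps)
  finally show ?thesis by (simp add: unocc_def prod_dividef)
qed

text \<open>The recursion is antitone, so each level swaps the two kinds of bound. \<open>up\<close>
  is the upper end of the oscillation and hence bounds the even values from below, starting from 1
  at \<open>k = 0\<close>; \<open>lo\<close> bounds the odd values from above.\<close>

lemma unocc_bounds:
  assumes lam: "lam > 0"
    and bounds: "\<And>p. p \<in> W \<Longrightarrow> 0 \<le> lo p \<and> 0 \<le> up p \<and> up p \<le> 1"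
    and up: "\<And>p. p \<in> W \<Longrightarrow> up p * (1 + lam * (\<Prod>v\<in>children p. lo (p @ [v]))) \<le> 1"
    and lo: "\<And>p. p \<in> W \<Longrightarrow> 1 \<le> lo p * (1 + lam * (\<Prod>v\<in>children p. up (p @ [v])))"
  shows "p \<in> W \<Longrightarrow> if even k then up p \<le> unocc lam p k else 0 \<le> unocc lam p k \<and> unocc lam p k \<le> lo p"
proof (induction k arbitrary: p)
  case 0
  then show ?case using bounds by (simp add: unocc_0)
next
  case (Suc k)
  have child: "p @ [v] \<in> W" if "v \<in> children p" for v using that by (simp add: children_def)
  let ?P = "\<Prod>v\<in>children p. unocc lam (p @ [v]) k"
  let ?up = "\<Prod>v\<in>children p. up (p @ [v])" and ?lo = "\<Prod>v\<in>children p. lo (p @ [v])"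
  show ?case
  proof (cases "even k")
    case True
    have "?up \<le> ?P"
      using Suc.IH child bounds True by (intro prod_mono) (auto split: if_splits)
    moreover have "0 \<le> ?up" using bounds child by (intro prod_nonneg) auto
    ultimately have le: "0 < 1 + lam * ?up" "1 + lam * ?up \<le> 1 + lam * ?P"
      using lam by (auto intro: add_pos_nonneg)
    then have "1 / (1 + lam * ?P) \<le> 1 / (1 + lam * ?up)" by (intro divide_left_mono) auto
    also have "\<dots> \<le> lo p" using lo[OF Suc.prems] le by (simp add: divide_le_eq)
    finally have "1 / (1 + lam * ?P) \<le> lo p" .
    moreover have "0 \<le> 1 / (1 + lam * ?P)" using le by (intro divide_nonneg_nonneg) linarith+
    ultimately show ?thesis using True Suc.prems lam by (simp add: unocc_Suc)
  next
    case False
    have "?P \<le> ?lo" "0 \<le> ?P"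
      using Suc.IH child False by (auto intro!: prod_mono prod_nonneg)
    then have le: "0 < 1 + lam * ?P" "1 + lam * ?P \<le> 1 + lam * ?lo"
      using lam by (auto intro: add_pos_nonneg)
    have "up p \<le> 1 / (1 + lam * ?lo)" using up[OF Suc.prems] le by (simp add: le_divide_eq)
    also have "\<dots> \<le> 1 / (1 + lam * ?P)" using le by (intro divide_left_mono) auto
    finally show ?thesis using False Suc.prems lam by (simp add: unocc_Suc)
  qed
qed

text \<open>
  Occupying the walks of \<open>W\<close> of depth \<open>L\<close> forces their parents to be unoccupied, so this boundary
  condition acts like cutting \<open>W\<close> one level earlier than the empty one.
\<close>

lemma SSM_imp_unocc_close:
  assumes lam: "lam > 0" and SSM: "SSM (walk_tree V) [r] lam"
  obtains \<gamma> where "0 < \<gamma>" "\<gamma> < 1"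
    "\<And>k. \<bar>unocc lam [r] k - unocc lam [r] (Suc k)\<bar> \<le> \<gamma> ^ Suc k"
proof -
  let ?T = "truncate (walk_tree V) [r]"
  from SSM obtain \<gamma> :: real where \<gamma>: "0 < \<gamma>" "\<gamma> < 1"
    and close: "\<forall>L S S' \<tau>\<^sub>1 \<tau>\<^sub>2. S \<subseteq> verts (?T L) \<and> S' \<subseteq> S \<and>
        compatible (?T L) S \<tau>\<^sub>1 \<and> compatible (?T L) S \<tau>\<^sub>2 \<and> (\<forall>x\<in>S - S'. \<tau>\<^sub>1 x = \<tau>\<^sub>2 x) \<longrightarrow>
        \<bar>p_unocc (?T L) lam [r] S \<tau>\<^sub>1 - p_unocc (?T L) lam [r] S \<tau>\<^sub>2\<bar>
          \<le> \<gamma> ^ set_dist (?T L) [r] S'"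
    unfolding SSM_def by (elim exE conjE)
  have "\<bar>unocc lam [r] k - unocc lam [r] (Suc k)\<bar> \<le> \<gamma> ^ Suc k" for k
  proof -
    define L where "L = Suc k"
    define VL where "VL = {p \<in> V. length p \<le> Suc L}"
    interpret VL: rooted_walks VL r unfolding VL_def by (rule rooted_walks_truncate)
    have T: "truncate (walk_tree V) [r] L = walk_tree VL"
      unfolding VL_def by (rule truncate_walk_tree)
    \<comment> \<open>\<open>S\<close> holds everything outside \<open>W\<close> and level
      \<open>L\<close> of \<open>W\<close>, whose walks have length \<open>Suc L\<close>. With all
      of \<open>S\<close> unoccupied, \<open>L\<close> levels of \<open>W\<close> stay free;
      occupying \<open>B\<close> leaves \<open>k\<close> of them.\<close>
    define S where "S = VL - branch [r] L"
    define B where "B = {x \<in> W. length x = Suc L}"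
    have prefix_root: "prefix [r] x" if "x \<in> W" for x
      using sub.hd_root[OF that] by (cases x) auto
    have branch_root: "branch [r] n = {x \<in> W. length x < Suc n}" for n
      using prefix_root by (auto simp: branch_def)
    have fin: "finite VL" unfolding VL_def by (rule finite_levels)
    have B: "B \<subseteq> S" "\<And>x y. x \<in> B \<Longrightarrow> y \<in> B \<Longrightarrow> \<not> adj x y"
      using subset adj_length by (fastforce simp: B_def S_def VL_def branch_root)+
    have SV: "S \<subseteq> VL" by (auto simp: S_def)
    have free: "branch [r] L = {x \<in> VL - S. \<forall>y\<in>{}. \<not> adj x y}"
      using subset by (auto simp: S_def VL_def branch_root)
    have forced: "branch [r] k = {x \<in> VL - S. \<forall>y\<in>B. \<not> adj x y}"
    proof (intro equalityI subsetI)
      fix x assume "x \<in> branch [r] k"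
      then show "x \<in> {x \<in> VL - S. \<forall>y\<in>B. \<not> adj x y}"
        using subset adj_length[of x] by (fastforce simp: branch_root S_def VL_def B_def L_def)
    next
      fix x assume x: "x \<in> {x \<in> VL - S. \<forall>y\<in>B. \<not> adj x y}"
      then have xW: "x \<in> W" "length x \<le> L" by (auto simp: S_def branch_root)
      obtain v where v: "x @ [v] \<in> W" using extendable xW by blast
      have "adj x (x @ [v])" by (simp add: adj_def)
      then have "x @ [v] \<notin> B" using x by auto
      then have "length x \<noteq> L" using v by (auto simp: B_def)
      then show "x \<in> branch [r] k" using xW by (auto simp: branch_root L_def)
    qed
    have root: "[r] \<in> VL" "[r] \<notin> B" using VL.root by (auto simp: B_def L_def)
    \<comment> \<open>For empty \<open>B\<close> the infimum in \<open>set_dist\<close> would be the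
      default value 0 instead of \<open>L\<close>.\<close>
    have "B \<noteq> {}"
    proof -
      have "\<exists>x\<in>W. length x = Suc n" for n
      proof (induction n)
        case 0
        then show ?case using sub.root by force
      next
        case (Suc n)
        then show ?case using extendable by (metis length_append_singleton)
      qed
      then show ?thesis by (auto simp: B_def)
    qed
    moreover have "graph_dist (walk_tree VL) [r] x = L" if "x \<in> B" for x
      using that B(1) SV VL.graph_dist_root[of x] by (auto simp: B_def)
    ultimately have "graph_dist (walk_tree VL) [r] ` B = {L}" by auto
    then have dist: "set_dist (walk_tree VL) [r] B = L" by (simp add: set_dist_def)
    have compat: "compatible (walk_tree VL) S (\<lambda>x. x \<in> C)" if "C \<subseteq> S" "\<And>x y. x \<in> C \<Longrightarrow> y \<in> C \<Longrightarrow> \<not> adj x y" for C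
      unfolding compatible_def
      by (rule bexI[of _ C]) (use that SV in \<open>auto simp: agrees_def indep_sets_walk_tree\<close>)
    have "\<bar>p_unocc (walk_tree VL) lam [r] S (\<lambda>x. x \<in> B) - p_unocc (walk_tree VL) lam [r] S (\<lambda>x. x \<in> {})\<bar>
        \<le> \<gamma> ^ L"
      using close[rule_format, of S L B "\<lambda>x. x \<in> B" "\<lambda>x. x \<in> {}"] B(1) SV
        compat[OF B] compat[of "{}"]
      unfolding T dist by auto
    moreover have "p_unocc (walk_tree VL) lam [r] S (\<lambda>x. x \<in> B) = unocc lam [r] k"
      unfolding unocc_def by (rule p_unocc_walk_tree[OF fin lam B(1) SV B(2) root forced])
    moreover have "p_unocc (walk_tree VL) lam [r] S (\<lambda>x. x \<in> {}) = unocc lam [r] L"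
      unfolding unocc_def by (rule p_unocc_walk_tree[OF fin lam _ SV _ root(1) _ free]) auto
    ultimately show ?thesis by (simp add: L_def)
  qed
  with \<gamma> that show ?thesis by blast
qed

text \<open>Consecutive values at the root have opposite parity and stay at least
  \<open>up [r] - lo [r]\<close> apart, whereas mixing would make their difference decay
  exponentially.\<close>

theorem not_SSM:
  assumes lam: "lam > 0"
    and bounds: "\<And>p. p \<in> W \<Longrightarrow> 0 \<le> lo p \<and> 0 \<le> up p \<and> up p \<le> 1"
    and up: "\<And>p. p \<in> W \<Longrightarrow> up p * (1 + lam * (\<Prod>v\<in>children p. lo (p @ [v]))) \<le> 1"
    and lo: "\<And>p. p \<in> W \<Longrightarrow> 1 \<le> lo p * (1 + lam * (\<Prod>v\<in>children p. up (p @ [v])))"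
    and gap: "lo [r] < up [r]"
  shows "\<not> SSM (walk_tree V) [r] lam"
proof
  assume "SSM (walk_tree V) [r] lam"
  then obtain \<gamma> where \<gamma>: "0 < \<gamma>" "\<gamma> < 1"
    and close: "\<And>k. \<bar>unocc lam [r] k - unocc lam [r] (Suc k)\<bar> \<le> \<gamma> ^ Suc k"
    using SSM_imp_unocc_close[OF lam] by metis
  have "up [r] - lo [r] \<le> \<bar>unocc lam [r] k - unocc lam [r] (Suc k)\<bar>" for k
    using unocc_bounds[OF lam bounds up lo sub.root, of k] unocc_bounds[OF lam bounds up lo sub.root, of "Suc k"]
    by (cases "even k") auto
  with close have *: "up [r] - lo [r] \<le> \<gamma> ^ Suc k" for k
    using order_trans by blast
  obtain n where n: "\<gamma> ^ n < up [r] - lo [r]"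
    using real_arch_pow_inv[of "up [r] - lo [r]" \<gamma>] gap \<gamma> by auto
  have "\<gamma> ^ Suc n \<le> \<gamma> ^ n" using \<gamma> by (intro power_decreasing) auto
  with *[of n] n show False by linarith
qed

end

section \<open>Partially directed walks\<close>

definition perp :: "site \<Rightarrow> site" where
  "perp d = (- snd d, fst d)"

text \<open>The inner product. For \<open>d\<close> in \<open>directions\<close>,
  \<open>along d\<close> and \<open>across d\<close> are coordinates in the orthonormal frame
  \<open>d\<close>, \<open>perp d\<close>, so all four directions are treated alike.\<close>

definition along :: "site \<Rightarrow> site \<Rightarrow> int" where
  "along d u = fst d * fst u + snd d * snd u"

abbreviation across :: "site \<Rightarrow> site \<Rightarrow> int" where
  "across d \<equiv> along (perp d)"

lemma along_simps [simp]:
  "along d (u + v) = along d u + along d v"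
  "along d (- u) = - along d u"
  "along d (u - v) = along d u - along d v"
  by (simp_all add: along_def algebra_simps)

lemma along_directions [simp]:
  assumes "d \<in> directions"
  shows "along d d = 1" "across d d = 0" "along d (perp d) = 0" "across d (perp d) = 1"
    "along d (- d) = - 1" "across d (- d) = 0" "along d (- perp d) = 0" "across d (- perp d) = - 1"
  using assms by (auto simp: directions_def along_def perp_def)

lemma directions_cases:
  assumes "d \<in> directions"
  shows "directions = {d, - d, perp d, - perp d}"
  using assms by (auto simp: directions_def perp_def)

lemma site_eqI:
  assumes "d \<in> directions" "along d u = along d v" "across d u = across d v"
  shows "u = v"
  using assms by (auto simp: directions_def along_def perp_def prod_eq_iff)

lemma neighbours_iff:
  assumes "d \<in> directions"
  shows "u \<in> neighbours v \<longleftrightarrow>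
    along d u = along d v \<and> \<bar>across d u - across d v\<bar> = 1 \<or>
    across d u = across d v \<and> \<bar>along d u - along d v\<bar> = 1"
proof
  assume "u \<in> neighbours v"
  then obtain m where "u = v + m" "m \<in> {d, - d, perp d, - perp d}"
    unfolding neighbours_def directions_cases[OF assms] by blast
  then show "along d u = along d v \<and> \<bar>across d u - across d v\<bar> = 1 \<or>
    across d u = across d v \<and> \<bar>along d u - along d v\<bar> = 1"
    using assms by auto
next
  assume *: "along d u = along d v \<and> \<bar>across d u - across d v\<bar> = 1 \<or>
    across d u = across d v \<and> \<bar>along d u - along d v\<bar> = 1"
  have "u - v \<in> {d, - d, perp d, - perp d}"
  proof -
    consider "along d u = along d v" "across d u = across d v + 1"
      | "along d u = along d v" "across d u = across d v - 1"
      | "across d u = across d v" "along d u = along d v + 1"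
      | "across d u = across d v" "along d u = along d v - 1"
      using * by linarith
    then show ?thesis
    proof cases
      case 1
      then have "u - v = perp d" using assms by (intro site_eqI[OF assms]) auto
      then show ?thesis by simp
    next
      case 2
      then have "u - v = - perp d" using assms by (intro site_eqI[OF assms]) auto
      then show ?thesis by simp
    next
      case 3
      then have "u - v = d" using assms by (intro site_eqI[OF assms]) auto
      then show ?thesis by simp
    next
      case 4
      then have "u - v = - d" using assms by (intro site_eqI[OF assms]) auto
      then show ?thesis by simp
    qed
  qed
  then have "u - v \<in> directions" using directions_cases[OF assms] by simp
  then show "u \<in> neighbours v" unfolding neighbours_def by (metis add_diff_cancel_left' diff_add_cancel image_eqI add.commute)
qed

text \<open>
  \<open>Turned e\<close> is the state of a walk whose last two steps are \<open>e, d\<close> with \<open>e\<close> perpendicular to \<open>d\<close>.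
  It is only used for the flag \<open>True\<close>, for which the steps \<open>e, d, - e\<close> are forbidden.
\<close>

datatype heading = Straight | Sideways site | Turned site

text \<open>Pairs of an allowed step and the state it leads to; \<open>- d\<close> never occurs and
  a sideways run never reverses directly.\<close>

fun turns :: "bool \<Rightarrow> site \<Rightarrow> heading \<Rightarrow> (site \<times> heading) set" where
  "turns b d Straight = {(d, Straight), (perp d, Sideways (perp d)), (- perp d, Sideways (- perp d))}"
| "turns b d (Sideways e) = {(d, if b then Turned e else Straight), (e, Sideways e)}"
| "turns b d (Turned e) = {(d, Straight), (e, Sideways e)}"

inductive pd_walk :: "bool \<Rightarrow> site \<Rightarrow> heading \<Rightarrow> site list \<Rightarrow> bool" for b d where
  start: "pd_walk b d Straight [(0, 0)]"
| step: "pd_walk b d s p \<Longrightarrow> (m, t) \<in> turns b d s \<Longrightarrow> pd_walk b d t (p @ [last p + m])"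

definition headings :: "site \<Rightarrow> heading set" where
  "headings d = insert Straight (Sideways ` {perp d, - perp d} \<union> Turned ` {perp d, - perp d})"

fun last_step :: "site \<Rightarrow> heading \<Rightarrow> site" where
  "last_step d (Sideways e) = e"
| "last_step d _ = d"

text \<open>
  The invariant relating the end \<open>v\<close> of a walk in state \<open>s\<close> to each earlier site \<open>u\<close>. The row just
  below \<open>v\<close> is controlled only if turning back is forbidden.
\<close>

fun behind :: "bool \<Rightarrow> site \<Rightarrow> heading \<Rightarrow> site \<Rightarrow> site \<Rightarrow> bool" where
  "behind b d Straight v u \<longleftrightarrow> along d u < along d v \<and>
     (b \<longrightarrow> along d u = along d v - 1 \<longrightarrow> across d u = across d v)"
| "behind b d (Sideways e) v u \<longleftrightarrow> along d u \<le> along d v \<and>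
     (along d u = along d v \<or> b \<and> along d u = along d v - 1 \<longrightarrow>
       across d e * across d u < across d e * across d v)"
| "behind b d (Turned e) v u \<longleftrightarrow> along d u < along d v \<and>
     (along d u = along d v - 1 \<longrightarrow> across d e * across d u \<le> across d e * across d v)"

section \<open>Invariant of the walks and adjacency to earlier sites\<close>

lemma perp_neq:
  assumes "d \<in> directions"
  shows "d \<noteq> perp d" "d \<noteq> - perp d" "perp d \<noteq> - perp d"
  using assms by (auto simp: directions_def perp_def)

lemma turns_step:
  assumes "d \<in> directions" "s \<in> headings d" "(m, t) \<in> turns b d s"
  shows "m \<in> {d, perp d, - perp d}" "m = last_step d t"
  using assms by (auto simp: headings_def)

lemma turns_functional:
  assumes "d \<in> directions" "s \<in> headings d" "(m, t) \<in> turns b d s" "(m, t') \<in> turns b d s"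
  shows "t = t'"
  using assms perp_neq[OF assms(1)] by (auto simp: headings_def)

text \<open>After \<open>e\<close>, \<open>d\<close> with the flag, the sites of the row just left
  lie weakly on the side opposite to \<open>e\<close>: a step \<open>e\<close> moves strictly past
  them, and a step \<open>d\<close> puts that row two rows back.\<close>

lemma turns_behind:
  assumes d: "d \<in> directions" and s: "s \<in> headings d" and t: "(m, t) \<in> turns b d s"
    and u: "behind b d s v u \<or> u = v"
  shows "behind b d t (v + m) u"
  using s t u d by (cases s) (auto simp: headings_def split: if_splits)

lemma pd_walk_headings: "d \<in> directions \<Longrightarrow> pd_walk b d s p \<Longrightarrow> s \<in> headings d"
  by (rotate_tac, induction rule: pd_walk.induct) (auto simp: headings_def split: if_splits)

lemma pd_walk_hd: "pd_walk b d s p \<Longrightarrow> p \<noteq> [] \<and> hd p = (0, 0)"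
  by (induction rule: pd_walk.induct) auto

lemma pd_walk_butlast: "pd_walk b d s p \<Longrightarrow> length p \<ge> 2 \<Longrightarrow> \<exists>t. pd_walk b d t (butlast p)"
  by (erule pd_walk.cases) auto

lemma set_butlast_last: "p \<noteq> [] \<Longrightarrow> set p = insert (last p) (set (butlast p))"
  by (cases p rule: rev_cases) auto

lemma pd_walk_behind:
  assumes "d \<in> directions" "pd_walk b d s p" "u \<in> set (butlast p)"
  shows "behind b d s (last p) u"
  using assms(2,3)
proof (induction arbitrary: u rule: pd_walk.induct)
  case (step s p m t)
  have "set p = insert (last p) (set (butlast p))"
    using pd_walk_hd[OF step.hyps(1)] set_butlast_last by blast
  moreover have "u \<in> set p" using step.prems by simp
  ultimately have "behind b d s (last p) u \<or> u = last p" using step.IH by blast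
  then show ?case
    using turns_behind[OF assms(1) pd_walk_headings[OF assms(1) step.hyps(1)] step.hyps(2)] by simp
qed simp

lemma pd_walk_last:
  assumes "d \<in> directions" "pd_walk b d s p" "length p \<ge> 2"
  shows "last p = last (butlast p) + last_step d s"
  using assms(2,3,1)
  by cases (auto dest: turns_step(2)[OF _ pd_walk_headings])

text \<open>No site is \<open>behind\<close> itself, so the new end differs from every earlier
  site.\<close>

lemma pd_walk_distinct:
  assumes d: "d \<in> directions" and p: "pd_walk b d s p"
  shows "distinct p"
  using p
proof (induction rule: pd_walk.induct)
  case (step s p m t)
  have "pd_walk b d t (p @ [last p + m])" using step.hyps by (rule pd_walk.step)
  from pd_walk_behind[OF d this, of "last p + m"] have "last p + m \<notin> set p"
    by (cases t) auto
  with step.IH show ?case by simp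
qed simp

lemma pd_walk_steps:
  assumes d: "d \<in> directions" and p: "pd_walk b d s p"
  shows "Suc i < length p \<Longrightarrow> p ! Suc i - p ! i \<in> {d, perp d, - perp d}"
  using p
proof (induction rule: pd_walk.induct)
  case (step s p m t)
  show ?case
  proof (cases "Suc i < length p")
    case True
    then show ?thesis using step by (simp add: nth_append)
  next
    case False
    then have i: "Suc i = length p" using step.prems by simp
    then have "p ! i = last p" using pd_walk_hd[OF step.hyps(1)] by (metis diff_Suc_1 last_conv_nth)
    then have "(p @ [last p + m]) ! Suc i - (p @ [last p + m]) ! i = m"
      using i by (simp add: nth_append)
    then show ?thesis
      using turns_step(1)[OF d pd_walk_headings[OF d step.hyps(1)] step.hyps(2)] by simp
  qed
qed simp

text \<open>In state \<open>Straight\<close> or \<open>Turned\<close> all earlier sites lie in lower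
  rows, so an earlier neighbour is the site just below, the predecessor. In state
  \<open>Sideways e\<close> the current row offers only the predecessor, and the invariant excludes
  the site below when the flag is set.\<close>

lemma pd_walk_adjacent:
  assumes d: "d \<in> directions" and p: "pd_walk b d s p"
    and u: "u \<in> set (butlast p)" "u \<in> neighbours (last p)"
  shows "u = last (butlast p) \<or> \<not> b \<and> last p = u + d"
proof -
  have "length p \<ge> 2" using u by (cases p rule: rev_cases; cases "butlast p") auto
  then have l: "last p = last (butlast p) + last_step d s" using pd_walk_last[OF d p] by simp
  have beh: "behind b d s (last p) u" using pd_walk_behind[OF d p] u by blast
  have s: "s \<in> headings d" using pd_walk_headings[OF d p] .
  have below: "last p = u + d" if "along d u < along d (last p)"
    using that u(2) d by (intro site_eqI[OF d]) (auto simp: neighbours_iff[OF d])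
  show ?thesis
  proof (cases s)
    case (Sideways e)
    then have e: "e = perp d \<or> e = - perp d" using s by (auto simp: headings_def)
    show ?thesis
    proof (cases "along d u = along d (last p)")
      case True
      then have "last p = u + e"
        using e d u(2) beh Sideways by (intro site_eqI[OF d]) (auto simp: neighbours_iff[OF d])
      then show ?thesis using l Sideways by simp
    next
      case False
      then have "last p = u + d" using beh Sideways below by simp
      moreover from this have "\<not> b" using beh Sideways d by auto
      ultimately show ?thesis by simp
    qed
  qed (use below beh l in auto)
qed

lemma pd_walk_heading_unique:
  assumes d: "d \<in> directions" and "pd_walk b d s p" "pd_walk b d t p"
  shows "s = t"
  using assms(2,3)
proof (induction arbitrary: t rule: pd_walk.induct)
  case start
  then show ?case
  proof cases
    case (step s p m)
    then have "p = []" by simp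
    with step(2) pd_walk_hd show ?thesis by blast
  qed simp
next
  case (step s p m t)
  note hyps = step.hyps step.IH
  from step.prems show ?case
  proof cases
    case start
    then show ?thesis using pd_walk_hd[OF hyps(1)] by simp
  next
    case (step s' p' m')
    then have "p' = p" "m' = m" by auto
    with step hyps show ?thesis using turns_functional[OF d] pd_walk_headings[OF d] by metis
  qed
qed

section \<open>The tree of walks and its finitely many vertex types\<close>

definition pd_walks :: "bool \<Rightarrow> site \<Rightarrow> site list set" where
  "pd_walks b d = {p. \<exists>s. pd_walk b d s p}"

definition heading_of :: "bool \<Rightarrow> site \<Rightarrow> site list \<Rightarrow> heading" where
  "heading_of b d p = (THE s. pd_walk b d s p)"

lemma heading_of: "d \<in> directions \<Longrightarrow> pd_walk b d s p \<Longrightarrow> heading_of b d p = s"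
  unfolding heading_of_def using pd_walk_heading_unique by blast

lemma pd_walk_snoc_iff:
  assumes d: "d \<in> directions" and p: "pd_walk b d s p"
  shows "p @ [v] \<in> pd_walks b d \<longleftrightarrow> v \<in> (\<lambda>(m, t). last p + m) ` turns b d s"
proof
  assume "p @ [v] \<in> pd_walks b d"
  then obtain t where "pd_walk b d t (p @ [v])" by (auto simp: pd_walks_def)
  then show "v \<in> (\<lambda>(m, t). last p + m) ` turns b d s"
  proof cases
    case start
    then show ?thesis using pd_walk_hd[OF p] by simp
  next
    case (step s' p' m)
    then have "p' = p" "v = last p + m" by auto
    with step have "(m, t) \<in> turns b d s" using pd_walk_heading_unique[OF d p] by metis
    with \<open>v = last p + m\<close> show ?thesis by (intro image_eqI[of _ _ "(m, t)"]) auto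
  qed
qed (auto simp: pd_walks_def intro: pd_walk.step[OF p])

text \<open>This reduces the recursion to the states: different allowed steps give different
  children, and the step determines the state of the child.\<close>

lemma prod_pd_walk:
  fixes g :: "heading \<Rightarrow> real"
  assumes d: "d \<in> directions" and p: "pd_walk b d s p"
  shows "(\<Prod>v | p @ [v] \<in> pd_walks b d. g (heading_of b d (p @ [v]))) = (\<Prod>(m, t)\<in>turns b d s. g t)"
proof -
  have s: "s \<in> headings d" using pd_walk_headings[OF d p] .
  have eq: "{v. p @ [v] \<in> pd_walks b d} = (\<lambda>(m, t). last p + m) ` turns b d s"
    by (simp add: pd_walk_snoc_iff[OF d p])
  have "inj_on (\<lambda>(m, t). last p + m) (turns b d s)"
    using turns_functional[OF d s] by (auto simp: inj_on_def)
  moreover have "heading_of b d (p @ [last p + m]) = t" if "(m, t) \<in> turns b d s" for m t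
    using heading_of[OF d pd_walk.step[OF p that]] .
  ultimately show ?thesis
    unfolding eq by (subst prod.reindex) (auto intro!: prod.cong)
qed

section \<open>Partially directed walks in the self-avoiding walk tree\<close>

abbreviation saw_verts :: "(site \<Rightarrow> site rel) \<Rightarrow> site list set" where
  "saw_verts \<sigma> \<equiv> verts (T_saw_ord \<sigma>)"

lemma saw_verts_iff:
  "p \<in> saw_verts \<sigma> \<longleftrightarrow> p \<in> saw_walks \<and> \<not> unoccupied_leaf \<sigma> p \<and>
     (\<forall>q. occupied_leaf \<sigma> q \<longrightarrow> \<not> prefix (butlast q) p)"
  by (auto simp: T_saw_ord_def T_saw_def induced_walk_tree)

lemma T_saw_ord_walk_tree: "T_saw_ord \<sigma> = walk_tree (saw_verts \<sigma>)"
  by (simp add: T_saw_ord_def T_saw_def induced_walk_tree)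

lemma saw_walks_distinct:
  assumes p: "p \<in> saw_walks" "distinct p"
  shows "\<not> unoccupied_leaf \<sigma> p"
proof
  assume "unoccupied_leaf \<sigma> p"
  then obtain i where i: "i < length p - 1" "p ! i = last p" by (auto simp: unoccupied_leaf_def)
  then have "p ! i = p ! (length p - 1)" by (metis last_conv_nth list.size(3) not_less_zero zero_diff)
  then show False using i p by (simp add: nth_eq_iff_index_eq)
qed

lemma saw_walksI:
  assumes "p \<noteq> []" "hd p = (0, 0)" "distinct p"
    and "\<And>i. Suc i < length p \<Longrightarrow> p ! Suc i \<in> neighbours (p ! i)"
  shows "p \<in> saw_walks"
proof -
  have "p ! (length p - 1) \<noteq> p ! (length p - 3)" if "length p \<ge> 3"
    using assms that by (subst nth_eq_iff_index_eq) auto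
  then show ?thesis using assms by (auto simp: saw_walks_def distinct_butlast)
qed

lemma saw_walks_butlast:
  assumes "p \<in> saw_walks" "length p \<ge> 2"
  shows "butlast p \<in> saw_walks" "distinct (butlast p)"
proof -
  show "distinct (butlast p)" using assms by (simp add: saw_walks_def)
  moreover have "butlast p \<noteq> []" "hd (butlast p) = (0, 0)"
    using assms by (cases p; auto simp: saw_walks_def)+
  moreover have "butlast p ! Suc i \<in> neighbours (butlast p ! i)" if "Suc i < length (butlast p)" for i
    using assms that by (auto simp: saw_walks_def nth_butlast)
  ultimately show "butlast p \<in> saw_walks" by (intro saw_walksI)
qed

lemma finite_saw_walks: "finite {p \<in> saw_walks. length p \<le> n}"
proof (induction n)
  case 0
  have "{p \<in> saw_walks. length p \<le> 0} = {}" by (auto simp: saw_walks_def)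
  then show ?case by simp
next
  case (Suc n)
  let ?A = "{p \<in> saw_walks. length p \<le> n}"
  have "p \<in> insert [(0, 0)] ((\<lambda>(q, m). q @ [last q + m]) ` (?A \<times> directions))"
    if p: "p \<in> saw_walks" "length p \<le> Suc n" for p
  proof (cases "length p \<ge> 2")
    case False
    then have "p = [(0, 0)]" using p by (cases p; cases "tl p") (auto simp: saw_walks_def)
    then show ?thesis by simp
  next
    case True
    then obtain q v where q: "p = q @ [v]" by (cases p rule: rev_cases) auto
    with True have "q \<noteq> []" by auto
    note q = q this
    have "q \<in> ?A" using saw_walks_butlast(1)[OF p(1) True] q p by simp
    moreover have "v \<in> neighbours (last q)"
    proof -
      have "Suc (length q - 1) < length p" using q by simp
      then have "p ! Suc (length q - 1) \<in> neighbours (p ! (length q - 1))"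
        using p(1) unfolding saw_walks_def by blast
      then show ?thesis using q by (simp add: nth_append last_conv_nth)
    qed
    then obtain m where "m \<in> directions" "v = last q + m" by (auto simp: neighbours_def)
    ultimately have "p = (\<lambda>(q, m). q @ [last q + m]) (q, m)" "(q, m) \<in> ?A \<times> directions"
      using q by auto
    then show ?thesis by blast
  qed
  then have "{p \<in> saw_walks. length p \<le> Suc n}
      \<subseteq> insert [(0, 0)] ((\<lambda>(q, m). q @ [last q + m]) ` (?A \<times> directions))"
    by blast
  moreover have "finite (insert [(0, 0)] ((\<lambda>(q, m). q @ [last q + m]) ` (?A \<times> directions)))"
    using Suc.IH by (simp add: directions_def)
  ultimately show ?case by (rule finite_subset)
qed

section \<open>Survival of partially directed walks under the deletions\<close>

lemma pd_walk_saw: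
  assumes d: "d \<in> directions" and p: "pd_walk b d s p"
  shows "p \<in> saw_walks"
proof (rule saw_walksI)
  fix i assume "Suc i < length p"
  then have "p ! Suc i - p ! i \<in> directions"
    using pd_walk_steps[OF d p] directions_cases[OF d] by blast
  then show "p ! Suc i \<in> neighbours (p ! i)"
    unfolding neighbours_def by (intro image_eqI[of _ _ "p ! Suc i - p ! i"]) auto
qed (use pd_walk_hd[OF p] pd_walk_distinct[OF d p] in auto)

lemma pd_walks_rooted: "d \<in> directions \<Longrightarrow> rooted_walks (pd_walks b d) (0, 0)"
  by unfold_locales (auto simp: pd_walks_def pd_walk_butlast intro: pd_walk.start dest: pd_walk_hd)

text \<open>The walk \<open>q\<close> returns to an earlier neighbour of the end of
  \<open>butlast q\<close>. The ban on immediate reversal excludes the predecessor, so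
  \<open>pd_walk_adjacent\<close> leaves only a closing step \<open>- d\<close>, without the
  flag.\<close>

lemma pd_walk_cycle:
  assumes d: "d \<in> directions" and p: "p \<in> pd_walks b d"
    and q: "q \<in> saw_walks" "prefix (butlast q) p" "i < length q - 1" "q ! i = last q"
  shows "\<not> b" "last (butlast q) = last q + d" "butlast q \<in> pd_walks b d"
proof -
  interpret rooted_walks "pd_walks b d" "(0, 0)" by (rule pd_walks_rooted[OF d])
  let ?p = "butlast q"
  have ne: "?p \<noteq> []" using q(3) by (cases q) auto
  show pq: "?p \<in> pd_walks b d" by (rule prefix_closed[OF p q(2) ne])
  then obtain s where s: "pd_walk b d s ?p" by (auto simp: pd_walks_def)
  have l2: "length q \<ge> 2" using q(3) by simp
  have i: "?p ! i = last q" using q by (simp add: nth_butlast)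
  have idx: "Suc (length ?p - 1) = length q - 1" "length q - 1 < length q" using l2 by auto
  then have "q ! (length q - 1) \<in> neighbours (q ! (length ?p - 1))"
    using q(1) unfolding saw_walks_def by (metis (mono_tags, lifting) mem_Collect_eq)
  moreover have q_last: "q ! (length q - 1) = last q"
    using l2 by (subst last_conv_nth) auto
  moreover have "q ! (length ?p - 1) = last ?p"
    using ne l2 by (simp add: last_conv_nth nth_butlast)
  ultimately have nb: "last q \<in> neighbours (last ?p)" by simp
  then have "last q \<noteq> last ?p" by (auto simp: neighbours_iff[OF d])
  moreover have "last q \<in> set ?p" using i q(3) by (metis length_butlast nth_mem)
  ultimately have u: "last q \<in> set (butlast ?p)"
    using set_butlast_last[OF ne] by blast
  then have ne': "butlast ?p \<noteq> []" by auto
  then have "length (butlast ?p) > 0" by (rule length_greater_0_conv[THEN iffD2])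
  then have l3: "length q \<ge> 3" by simp
  then have "q ! (length q - 1) \<noteq> q ! (length q - 3)" using q(1) by (simp add: saw_walks_def)
  moreover have "q ! (length q - 3) = last (butlast ?p)"
    using ne' l3 by (simp add: last_conv_nth nth_butlast numeral_3_eq_3)
  ultimately have "last q \<noteq> last (butlast ?p)" using q_last by simp
  then show "\<not> b" "last ?p = last q + d"
    using pd_walk_adjacent[OF d s u nb] by auto
qed

text \<open>Being self-avoiding, \<open>p\<close> can only be removed by an occupied leaf
  \<open>q\<close> with \<open>butlast q\<close> a prefix of \<open>p\<close>. The cycle of
  \<open>q\<close> closes from \<open>last q + d\<close>, so it would have to start with a sideways
  step smaller than \<open>d\<close>, contrary to \<open>strict\<close>.\<close>

lemma pd_walks_subset:
  assumes d: "d \<in> directions"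
    and strict: "\<not> b \<Longrightarrow> (\<forall>v m. m \<in> {perp d, - perp d} \<longrightarrow> (v + m, v + d) \<notin> \<sigma> v)"
  shows "pd_walks b d \<subseteq> saw_verts \<sigma>"
proof
  fix p assume p: "p \<in> pd_walks b d"
  then obtain s where s: "pd_walk b d s p" by (auto simp: pd_walks_def)
  have "\<not> prefix (butlast q) p" if q: "occupied_leaf \<sigma> q" for q
  proof
    assume pre: "prefix (butlast q) p"
    let ?p = "butlast q"
    obtain i where i: "i < length q - 1" "q ! i = last q" "q ! Suc i \<noteq> q ! (length q - 2)"
        "(q ! Suc i, q ! (length q - 2)) \<in> \<sigma> (last q)" and saw: "q \<in> saw_walks"
      using q by (auto simp: occupied_leaf_def)
    note cyc = pd_walk_cycle[OF d p saw pre i(1,2)]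
    obtain t where t: "pd_walk b d t ?p" using cyc(3) by (auto simp: pd_walks_def)
    have "q ! (length q - 2) = last ?p"
      using i(1) pd_walk_hd[OF t] by (subst last_conv_nth) (auto simp: nth_butlast numeral_2_eq_2)
    then have top: "q ! (length q - 2) = last q + d" using cyc(2) by simp
    \<comment> \<open>The first step of the cycle thus lies within \<open>?p\<close>, where
      \<open>pd_walk_steps\<close> leaves \<open>d\<close> and the sideways steps; \<open>d\<close>
      is excluded because it leads to \<open>last q + d\<close>.\<close>
    have "Suc i \<noteq> length q - 1"
    proof
      assume "Suc i = length q - 1"
      then have "i = length q - 2" by simp
      then have "last q = last q + d" using top i(2) by simp
      then show False using d by (auto simp: directions_def zero_prod_def)
    qed
    then have "Suc i < length ?p" using i(1) by simp
    then have "?p ! Suc i - ?p ! i \<in> {d, perp d, - perp d}" by (rule pd_walk_steps[OF d t])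
    then have "q ! Suc i - last q \<in> {d, perp d, - perp d}"
      using \<open>Suc i < length ?p\<close> i by (simp add: nth_butlast)
    moreover have "q ! Suc i - last q \<noteq> d" using i(3) top by (auto simp: algebra_simps)
    ultimately have m: "q ! Suc i - last q \<in> {perp d, - perp d}" by simp
    have "(last q + (q ! Suc i - last q), last q + d) \<in> \<sigma> (last q)" using i(4) top by simp
    then show False using strict[OF cyc(1)] m by blast
  qed
  then show "p \<in> saw_verts \<sigma>"
    unfolding saw_verts_iff
    using saw_walks_distinct[OF pd_walk_saw[OF d s] pd_walk_distinct[OF d s]] pd_walk_saw[OF d s] by blast
qed

lemma saw_subtree:
  assumes d: "d \<in> directions" and sub: "pd_walks b d \<subseteq> saw_verts \<sigma>"
  shows "walk_subtree (saw_verts \<sigma>) (pd_walks b d) (0, 0)"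
proof -
  interpret W: rooted_walks "pd_walks b d" "(0, 0)" by (rule pd_walks_rooted[OF d])
  show ?thesis
  proof unfold_locales
    show "[(0, 0)] \<in> saw_verts \<sigma>" using W.root sub by blast
    show "p \<noteq> [] \<and> hd p = (0, 0)" if "p \<in> saw_verts \<sigma>" for p
      using that by (simp add: saw_verts_iff saw_walks_def)
    show "butlast p \<in> saw_verts \<sigma>" if p: "p \<in> saw_verts \<sigma>" "length p \<ge> 2" for p
    proof -
      have "p \<in> saw_walks" using p by (simp add: saw_verts_iff)
      note saw = saw_walks_butlast[OF this p(2)]
      have "\<not> prefix (butlast q) (butlast p)" if "occupied_leaf \<sigma> q" for q
        using that p(1) prefix_order.order_trans[OF _ prefixeq_butlast] by (auto simp: saw_verts_iff)
      then show ?thesis using saw saw_walks_distinct by (auto simp: saw_verts_iff)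
    qed
    show "pd_walks b d \<subseteq> saw_verts \<sigma>" by (rule sub)
    show "finite {p \<in> saw_verts \<sigma>. length p \<le> n}" for n
      by (rule finite_subset[OF _ finite_saw_walks[of n]]) (auto simp: saw_verts_iff)
    show "\<exists>v. p @ [v] \<in> pd_walks b d" if p: "p \<in> pd_walks b d" for p
    proof -
      obtain s where s: "pd_walk b d s p" using p by (auto simp: pd_walks_def)
      \<comment> \<open>The step \<open>d\<close> is allowed in every state, so no walk of the
        subtree is a dead end.\<close>
      obtain t where "(d, t) \<in> turns b d s" by (cases s) auto
      then show ?thesis using pd_walk.step[OF s] unfolding pd_walks_def by blast
    qed
  qed
qed

text \<open>
  The subscripts 1, 2, 3 refer to the states \<open>Straight\<close>, \<open>Sideways\<close> and \<open>Turned\<close>.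
\<close>

lemma not_SSM_pd_walks:
  fixes lam up\<^sub>1 up\<^sub>2 up\<^sub>3 lo\<^sub>1 lo\<^sub>2 lo\<^sub>3 :: real
  assumes d: "d \<in> directions" and sub: "pd_walks b d \<subseteq> saw_verts \<sigma>" and lam: "lam > 0"
    and bounds: "0 \<le> lo\<^sub>1" "0 \<le> lo\<^sub>2" "0 \<le> lo\<^sub>3" "0 \<le> up\<^sub>1" "0 \<le> up\<^sub>2" "0 \<le> up\<^sub>3"
      "up\<^sub>1 \<le> 1" "up\<^sub>2 \<le> 1" "up\<^sub>3 \<le> 1"
    and up: "up\<^sub>1 * (1 + lam * (lo\<^sub>1 * lo\<^sub>2 ^ 2)) \<le> 1"
      "up\<^sub>2 * (1 + lam * (lo\<^sub>2 * (if b then lo\<^sub>3 else lo\<^sub>1))) \<le> 1"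
      "up\<^sub>3 * (1 + lam * (lo\<^sub>2 * lo\<^sub>1)) \<le> 1"
    and lo: "1 \<le> lo\<^sub>1 * (1 + lam * (up\<^sub>1 * up\<^sub>2 ^ 2))"
      "1 \<le> lo\<^sub>2 * (1 + lam * (up\<^sub>2 * (if b then up\<^sub>3 else up\<^sub>1)))"
      "1 \<le> lo\<^sub>3 * (1 + lam * (up\<^sub>2 * up\<^sub>1))"
    and gap: "lo\<^sub>1 < up\<^sub>1"
  shows "\<not> SSM (T_saw_ord \<sigma>) saw_root lam"
proof -
  interpret walk_subtree "saw_verts \<sigma>" "pd_walks b d" "(0, 0)" by (rule saw_subtree[OF d sub])
  define up where "up = case_heading up\<^sub>1 (\<lambda>_. up\<^sub>2) (\<lambda>_. up\<^sub>3)"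
  define lo where "lo = case_heading lo\<^sub>1 (\<lambda>_. lo\<^sub>2) (\<lambda>_. lo\<^sub>3)"
  have [simp]: "up Straight = up\<^sub>1" "up (Sideways e) = up\<^sub>2" "up (Turned e) = up\<^sub>3"
    "lo Straight = lo\<^sub>1" "lo (Sideways e) = lo\<^sub>2" "lo (Turned e) = lo\<^sub>3" for e
    by (simp_all add: up_def lo_def)
  \<comment> \<open>\<open>perp_neq\<close> keeps the members of \<open>turns\<close> distinct; the
    square stems from the two sideways children of a \<open>Straight\<close> walk.\<close>
  have prod: "(\<Prod>(m, t)\<in>turns b d s. g t) = (case s of Straight \<Rightarrow> x * y ^ 2
      | Sideways _ \<Rightarrow> y * (if b then z else x) | Turned _ \<Rightarrow> y * x)"
    if "s \<in> headings d" "g Straight = x" "\<And>e. g (Sideways e) = y" "\<And>e. g (Turned e) = z"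
    for s and g :: "heading \<Rightarrow> real" and x y z
    using that perp_neq[OF d]
    by (cases s) (auto simp: headings_def power2_eq_square)
  have prod_lo: "(\<Prod>v\<in>children p. lo (heading_of b d (p @ [v]))) = (case s of Straight \<Rightarrow> lo\<^sub>1 * lo\<^sub>2 ^ 2
      | Sideways _ \<Rightarrow> lo\<^sub>2 * (if b then lo\<^sub>3 else lo\<^sub>1) | Turned _ \<Rightarrow> lo\<^sub>2 * lo\<^sub>1)"
    and prod_up: "(\<Prod>v\<in>children p. up (heading_of b d (p @ [v]))) = (case s of Straight \<Rightarrow> up\<^sub>1 * up\<^sub>2 ^ 2
      | Sideways _ \<Rightarrow> up\<^sub>2 * (if b then up\<^sub>3 else up\<^sub>1) | Turned _ \<Rightarrow> up\<^sub>2 * up\<^sub>1)"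
    if s: "pd_walk b d s p" for p s
    unfolding children_def prod_pd_walk[OF d s] by (rule prod[OF pd_walk_headings[OF d s]]; simp)+
  have "\<not> SSM (walk_tree (saw_verts \<sigma>)) [(0, 0)] lam"
  proof (rule not_SSM[OF lam, where lo = "\<lambda>p. lo (heading_of b d p)" and up = "\<lambda>p. up (heading_of b d p)"])
    fix p assume "p \<in> pd_walks b d"
    then obtain s where s: "pd_walk b d s p" by (auto simp: pd_walks_def)
    note eq = heading_of[OF d s]
    show "0 \<le> lo (heading_of b d p) \<and> 0 \<le> up (heading_of b d p) \<and> up (heading_of b d p) \<le> 1"
      unfolding eq using bounds by (cases s) auto
    show "up (heading_of b d p) * (1 + lam * (\<Prod>v\<in>children p. lo (heading_of b d (p @ [v])))) \<le> 1"
      unfolding eq prod_lo[OF s] using up by (cases s) auto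
    show "1 \<le> lo (heading_of b d p) * (1 + lam * (\<Prod>v\<in>children p. up (heading_of b d (p @ [v]))))"
      unfolding eq prod_up[OF s] using lo by (cases s) auto
  next
    show "lo (heading_of b d [(0, 0)]) < up (heading_of b d [(0, 0)])"
      using gap heading_of[OF d pd_walk.start] by simp
  qed
  then show ?thesis by (simp add: T_saw_ord_walk_tree[symmetric] saw_root_def)
qed

section \<open>Oscillating solutions of the recursion\<close>

text \<open>
  For the ratios $R = 1 / x - 1$, the recursion on the two states \<open>Sideways\<close> and \<open>Straight\<close> reads
  $b' = \lambda / ((1 + a) (1 + b))$, $a' = \lambda / ((1 + a) (1 + b)^2)$. Eliminating
  $a' = b' / (1 + b)$, a proper 2-cycle $b, B$ satisfies $b B = 1$ and $b + B = \lambda - 1$.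
\<close>

lemma two_cycle:
  fixes b B lam :: real
  assumes "b > 0" "B > 0" "b * B = 1" "b + B = lam - 1"
  shows "(1 + B) / lam * (1 + lam * ((1 + b) / lam * (1 / (1 + B)) ^ 2)) = 1"
    and "1 / (1 + b) * (1 + lam * (1 / (1 + B) * ((1 + b) / lam))) = 1"
proof -
  have lam: "lam = 1 + b + B" "lam \<noteq> 0" and B: "1 + B \<noteq> 0" "1 + b \<noteq> 0" using assms by auto
  have eq: "(1 + B) ^ 2 + (1 + b) = lam * (1 + B)"
    unfolding lam(1) using assms(3) by (simp add: algebra_simps power2_eq_square)
  have "lam * ((1 + b) / lam * (1 / (1 + B)) ^ 2) = (1 + b) / (1 + B) ^ 2"
    using lam(2) by (simp add: power_divide)
  also have "1 + \<dots> = ((1 + B) ^ 2 + (1 + b)) / (1 + B) ^ 2"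
    using B by (simp add: add_divide_distrib)
  finally show "(1 + B) / lam * (1 + lam * ((1 + b) / lam * (1 / (1 + B)) ^ 2)) = 1"
    using lam(2) B unfolding eq by (simp add: power2_eq_square)
  have "lam * (1 / (1 + B) * ((1 + b) / lam)) = (1 + b) / (1 + B)" using lam(2) by simp
  moreover have "1 / (1 + b) * (1 + (1 + b) / (1 + B)) = 1 / (1 + b) + 1 / (1 + B)"
    unfolding distrib_left using B by simp
  moreover have "\<dots> = (2 + b + B) / (1 + b + B + b * B)"
    using B by (simp add: add_frac_eq algebra_simps)
  ultimately show "1 / (1 + b) * (1 + lam * (1 / (1 + B) * ((1 + b) / lam))) = 1"
    using assms by simp
qed

text \<open>
  With $\lambda = (17 + t) / 5$, the ratios of the lower bounds are taken proportional to $\lambda$, namely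
  $55 \lambda / 234$, $71 \lambda / 234$ and $94 \lambda / 234$. This direction, found numerically, is close to the
  unstable one of the fixed point at $\lambda = 3.4$. The upper bounds are the images of the lower ones,
  and the first three inequalities say that the images of the upper bounds are at most the lower
  ones. In each of them all coefficients of the difference, as a polynomial in $t$, are positive.
\<close>

lemma three_state_bounds:
  fixes t :: real
  assumes "t \<ge> 0"
  defines "x \<equiv> 421 + 11 * t" and "y \<equiv> 2377 + 71 * t" and "w \<equiv> 1384 + 47 * t"
  defines "a \<equiv> x * y ^ 2" and "h \<equiv> y * w" and "c \<equiv> x * y"
  shows "55 * ((a + 64064520 * (17 + t)) * (h + 136890 * (17 + t)) ^ 2) \<le> 234 * (a * h ^ 2)"
    and "71 * ((h + 136890 * (17 + t)) * (c + 54756 * (17 + t))) \<le> 234 * (h * c)"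
    and "94 * ((a + 64064520 * (17 + t)) * (h + 136890 * (17 + t))) \<le> 234 * (a * h)"
    and "234 * (a + 64064520 * (17 + t)) < x * a"
proof -
  \<comment> \<open>The largest degree is 7, that of \<open>a * h ^ 2\<close>; powers are nested to
    the right to match the normal form of \<open>algebra_simps\<close>.\<close>
  have nn: "t \<ge> 0" "t * t \<ge> 0" "t * (t * t) \<ge> 0" "t * (t * (t * t)) \<ge> 0" "t * (t * (t * (t * t))) \<ge> 0"
    "t * (t * (t * (t * (t * t)))) \<ge> 0" "t * (t * (t * (t * (t * (t * t))))) \<ge> 0"
    using assms(1) by auto
  note [simp] = a_def h_def c_def x_def y_def w_def algebra_simps power2_eq_square
  show "71 * ((h + 136890 * (17 + t)) * (c + 54756 * (17 + t))) \<le> 234 * (h * c)"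
    using nn by simp
  show "94 * ((a + 64064520 * (17 + t)) * (h + 136890 * (17 + t))) \<le> 234 * (a * h)"
    using nn by simp
  show "55 * ((a + 64064520 * (17 + t)) * (h + 136890 * (17 + t)) ^ 2) \<le> 234 * (a * h ^ 2)"
    using nn by simp
  show "234 * (a + 64064520 * (17 + t)) < x * a"
    using nn by simp (intro add_nonneg_pos mult_nonneg_nonneg; simp)
qed

section \<open>The thresholds for arbitrary and for homogeneous orderings\<close>

lemma finite_linear_order_min:
  assumes "linear_order_on A R" "finite B" "B \<noteq> {}" "B \<subseteq> A"
  shows "\<exists>x\<in>B. \<forall>y\<in>B. (x, y) \<in> R"
  using assms(2-4)
proof (induction rule: finite_ne_induct)
  case (singleton x)
  then show ?case using assms(1) by (auto simp: order_on_defs refl_on_def)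
next
  case (insert x B)
  then obtain y where y: "y \<in> B" "\<forall>z\<in>B. (y, z) \<in> R" by auto
  have "(x, x) \<in> R" "(x, y) \<in> R \<or> (y, x) \<in> R" and tr: "trans R"
    using insert y assms(1) by (auto simp: order_on_defs refl_on_def total_on_def)
  then consider "\<forall>z\<in>insert x B. (x, z) \<in> R" | "\<forall>z\<in>insert x B. (y, z) \<in> R"
    using y transD[OF tr] by blast
  then show ?case using y by cases auto
qed

lemma not_SSM_any_ordering:
  assumes lam: "lam > 3.4"
  shows "\<not> SSM (T_saw_ord \<sigma>) saw_root lam"
proof -
  \<comment> \<open>The flag \<open>True\<close> makes the subtree available for every ordering, so
    the direction is a free choice.\<close>
  have d: "(0, 1) \<in> directions" by (simp add: directions_def)
  define t where "t = 5 * lam - 17"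
  have t: "t \<ge> 0" and lam_t: "lam = (17 + t) / 5" using lam by (auto simp: t_def)
  \<comment> \<open>A ratio \<open>R\<close> belongs to the probability \<open>1 / (1 + R)\<close>:
    55, 71 and 94 times \<open>lam / 234\<close> give \<open>234 / x\<close>,
    \<open>1170 / y\<close> and \<open>585 / w\<close>.\<close>
  define x y w where "x = 421 + 11 * t" and "y = 2377 + 71 * t" and "w = 1384 + 47 * t"
  define a h c where "a = x * y ^ 2" and "h = y * w" and "c = x * y"
  \<comment> \<open>The constants are one fifth of \<open>234 * 1170 ^ 2\<close>,
    \<open>1170 * 585\<close> and \<open>1170 * 234\<close>, from the numerators of the lower bounds
    and \<open>lam = (17 + t) / 5\<close>; hence \<open>a / a'\<close>, \<open>h / h'\<close>,
    \<open>c / c'\<close> are the images of the lower bounds.\<close>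
  define a' h' c' where "a' = a + 64064520 * (17 + t)" and "h' = h + 136890 * (17 + t)"
    and "c' = c + 54756 * (17 + t)"
  note ineqs = three_state_bounds[OF t, folded x_def y_def w_def, folded a_def h_def c_def, folded a'_def h'_def c'_def]
  have pos: "x > 0" "y > 0" "w > 0" using t by (auto simp: x_def y_def w_def)
  have pos1: "a > 0" "h > 0" "c > 0" using pos by (auto simp: a_def h_def c_def)
  have pos': "a' > 0" "h' > 0" "c' > 0" "a \<le> a'" "h \<le> h'" "c \<le> c'"
    using pos1 t by (auto simp: a'_def h'_def c'_def intro!: add_pos_nonneg)
  have up: "a / a' * (1 + lam * (234 / x * (1170 / y) ^ 2)) = 1"
    "h / h' * (1 + lam * (1170 / y * (585 / w))) = 1"
    "c / c' * (1 + lam * (1170 / y * (234 / x))) = 1"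
  proof -
    have "lam * (234 / x * (1170 / y) ^ 2) = 64064520 * (17 + t) / a"
      "lam * (1170 / y * (585 / w)) = 136890 * (17 + t) / h"
      "lam * (1170 / y * (234 / x)) = 54756 * (17 + t) / c"
      using pos by (simp_all add: lam_t a_def h_def c_def power_divide field_simps)
    then have "1 + lam * (234 / x * (1170 / y) ^ 2) = a' / a"
      "1 + lam * (1170 / y * (585 / w)) = h' / h"
      "1 + lam * (1170 / y * (234 / x)) = c' / c"
      using pos1 by (simp_all add: a'_def h'_def c'_def add_divide_distrib)
    then show "a / a' * (1 + lam * (234 / x * (1170 / y) ^ 2)) = 1"
      "h / h' * (1 + lam * (1170 / y * (585 / w))) = 1"
      "c / c' * (1 + lam * (1170 / y * (234 / x))) = 1"
      using pos1 pos' by simp_all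
  qed
  \<comment> \<open>A lower bound \<open>N / n\<close> with ratio \<open>k * lam / 234\<close> meets
    its condition once the product \<open>r\<close> of upper bounds is at least
    \<open>k / 234\<close>, which the first three \<open>ineqs\<close> supply.\<close>
  have lo: "1 \<le> N / n * (1 + lam * r)" if "n = N + N * (k / 234) * lam" "N > 0" "k / 234 \<le> r" "k > 0" for N n k r
  proof -
    have "n > 0" using that lam by (auto intro!: add_pos_nonneg)
    have "n = N * (1 + k / 234 * lam)" using that by (simp add: algebra_simps)
    also have "\<dots> \<le> N * (1 + lam * r)"
      using that lam by (intro mult_left_mono add_left_mono) (auto simp: mult.commute intro!: mult_left_mono)
    finally show ?thesis using \<open>n > 0\<close> by (simp add: le_divide_eq)
  qed
  show ?thesis
  proof (rule not_SSM_pd_walks[OF d, where b = True and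
        up\<^sub>1 = "a / a'" and up\<^sub>2 = "h / h'" and up\<^sub>3 = "c / c'" and
        lo\<^sub>1 = "234 / x" and lo\<^sub>2 = "1170 / y" and lo\<^sub>3 = "585 / w"])
    show "pd_walks True (0, 1) \<subseteq> saw_verts \<sigma>" by (rule pd_walks_subset[OF d]) simp
    show "a / a' * (1 + lam * (234 / x * (1170 / y) ^ 2)) \<le> 1"
      "h / h' * (1 + lam * (1170 / y * (if True then 585 / w else 234 / x))) \<le> 1"
      "c / c' * (1 + lam * (1170 / y * (234 / x))) \<le> 1"
      using up by simp_all
    show "1 \<le> 234 / x * (1 + lam * (a / a' * (h / h') ^ 2))"
      using ineqs(1) pos' by (intro lo[where k = 55]) (auto simp: x_def t_def divide_simps power_divide algebra_simps)
    show "1 \<le> 1170 / y * (1 + lam * (h / h' * (if True then c / c' else a / a')))"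
      using ineqs(2) pos' by (intro lo[where k = 71]) (auto simp: y_def t_def divide_simps power_divide algebra_simps)
    show "1 \<le> 585 / w * (1 + lam * (h / h' * (a / a')))"
      using ineqs(3) pos' by (intro lo[where k = 94]) (auto simp: w_def t_def divide_simps power_divide algebra_simps)
    show "234 / x < a / a'" using ineqs(4) pos pos' by (simp add: divide_simps a'_def mult.commute)
  qed (use lam pos pos1 pos' in auto)
qed

lemma not_SSM_homogeneous:
  assumes hom: "homogeneous \<sigma>" and lam: "lam > 3"
  shows "\<not> SSM (T_saw_ord \<sigma>) saw_root lam"
proof -
  obtain R where R: "linear_order_on directions R"
    "\<And>v d e. d \<in> directions \<Longrightarrow> e \<in> directions \<Longrightarrow> (v + d, v + e) \<in> \<sigma> v \<longleftrightarrow> (d, e) \<in> R"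
    using hom unfolding homogeneous_def by blast
  \<comment> \<open>Cycles can only close from the neighbour in direction \<open>d\<close>; with
    \<open>d\<close> smallest, such leaves are unoccupied.\<close>
  obtain d where d: "d \<in> directions" and min: "\<forall>m\<in>directions. (d, m) \<in> R"
    using finite_linear_order_min[OF R(1), of directions] by (auto simp: directions_def)
  have sub: "pd_walks False d \<subseteq> saw_verts \<sigma>"
  proof (rule pd_walks_subset[OF d], intro allI impI notI)
    fix v m assume m: "m \<in> {perp d, - perp d}" and *: "(v + m, v + d) \<in> \<sigma> v"
    have md: "m \<in> directions" "m \<noteq> d" using m directions_cases[OF d] perp_neq[OF d] by auto
    then have "(m, d) \<in> R" using * R(2) d by blast
    moreover have "antisym R" using R(1) by (auto simp: order_on_defs)
    ultimately show False using min md by (auto dest: antisymD)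
  qed
  \<comment> \<open>\<open>b\<close> and \<open>B\<close> are the roots of
    \<open>z ^ 2 - (lam - 1) * z + 1\<close>, whose discriminant is positive because
    \<open>lam > 3\<close>.\<close>
  define s where "s = sqrt ((lam - 1) ^ 2 - 4)"
  define b B where "b = (lam - 1 - s) / 2" and "B = (lam - 1 + s) / 2"
  have "(lam - 1) ^ 2 > 2 ^ 2" using lam by (intro power_strict_mono) auto
  then have s: "s > 0" "s ^ 2 = (lam - 1) ^ 2 - 4" by (auto simp: s_def)
  have prod: "b * B = 1" using s(2) by (simp add: b_def B_def field_simps power2_eq_square)
  have B: "B > 0" using s lam by (simp add: B_def)
  then have b: "b > 0" using prod by (metis zero_less_mult_pos2 zero_less_one)
  have sum: "b + B = lam - 1" "B + b = lam - 1" by (simp_all add: b_def B_def field_simps)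
  have "b < B" using s by (simp add: b_def B_def)
  note eqs = two_cycle[OF b B prod sum(1)] two_cycle[OF B b _ sum(2)]
  have prod': "B * b = 1" using prod by (simp add: mult.commute)
  show ?thesis
  \<comment> \<open>The values \<open>1 / (1 + b)\<close> and \<open>(1 + B) / lam\<close> are the
    probabilities of the ratios \<open>b\<close> and \<open>b / (1 + B)\<close>. Without the flag,
    \<open>Turned\<close> has the recursion of \<open>Sideways\<close> and takes the same
    values.\<close>
  proof (rule not_SSM_pd_walks[OF d sub, where
        up\<^sub>1 = "(1 + B) / lam" and up\<^sub>2 = "1 / (1 + b)" and up\<^sub>3 = "1 / (1 + b)" and
        lo\<^sub>1 = "(1 + b) / lam" and lo\<^sub>2 = "1 / (1 + B)" and lo\<^sub>3 = "1 / (1 + B)"])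
    show "(1 + B) / lam * (1 + lam * ((1 + b) / lam * (1 / (1 + B)) ^ 2)) \<le> 1"
      "1 / (1 + b) * (1 + lam * (1 / (1 + B) * (if False then 1 / (1 + B) else (1 + b) / lam))) \<le> 1"
      "1 / (1 + b) * (1 + lam * (1 / (1 + B) * ((1 + b) / lam))) \<le> 1"
      "1 \<le> (1 + b) / lam * (1 + lam * ((1 + B) / lam * (1 / (1 + b)) ^ 2))"
      "1 \<le> 1 / (1 + B) * (1 + lam * (1 / (1 + b) * (if False then 1 / (1 + b) else (1 + B) / lam)))"
      "1 \<le> 1 / (1 + B) * (1 + lam * (1 / (1 + b) * ((1 + B) / lam)))"
      by (simp_all only: if_False eqs(1,2) eqs(3,4)[OF prod'] order_refl)
    show "(1 + B) / lam \<le> 1" using sum b lam by simp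
    show "(1 + b) / lam < (1 + B) / lam" using \<open>b < B\<close> lam by (intro divide_strict_right_mono) auto
  qed (use lam b B in auto)
qed

theorem theorem1:
  shows "(\<forall>\<sigma> (lam::real). nbr_ordering \<sigma> \<longrightarrow> lam > 3.4 \<longrightarrow> \<not> SSM (T_saw_ord \<sigma>) saw_root lam) \<and>
    (\<forall>\<sigma> (lam::real). nbr_ordering \<sigma> \<longrightarrow> homogeneous \<sigma> \<longrightarrow> lam > 3 \<longrightarrow>
        \<not> SSM (T_saw_ord \<sigma>) saw_root lam)"
  using not_SSM_any_ordering not_SSM_homogeneous by blast

end
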